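(* Let $n \ge 18$ and let $\mathcal{F} \subseteq 2^{[n]}$ be an intersecting $B$-free family of subsets of $[n]=\{1,\dots,n\}$. Then \[ |\mathcal{F}| \le \Sigma_I(n,2). \] Equality holds if and only if: (i) for $n$ odd, $\mathcal{F} = \mathcal{H}_{0,n,2}=\binom{[n]}{\lfloor n/2\rfloor+1}\cup\binom{[n]}{\lfloor n/2\rfloor+2}$; (ii) for $n$ even, $\mathcal{F} = \mathcal{H}_{x,n,2}$ for some $x\in[n]$, where \[ \mathcal{H}_{x,n,2}=\{F\in\tbinom{[n]}{n/2}: x\in F\}\cup\tbinom{[n]}{n/2+1}\cup\{F\in\tbinom{[n]}{n/2+2}: x\notin F\}. \]
   Context: $\binom{[n]}{k}$ denotes the family of all $k$-element subsets of $[n]$. A family is intersecting if any two of its members have nonempty intersection. The butterfly poset $B$ has four elements $w,x,y,z$ with relations $w,x\le y,z$. A family $\mathcal{F}$ is $B$-free if it does not contain $B$ as a subposet (under inclusion), i.e. there are no four distinct sets $A_1,A_2,A_3,A_4\in\mathcal{F}$ with $A_1,A_2\subseteq A_3$ and $A_1,A_2\subseteq A_4$. Define \[ \Sigma_I(n,k)=\begin{cases}\sum_{i=(n+1)/2}^{(n+1)/2+k-1}\binom{n}{i}, & n \text{ odd},\\ \binom{n-1}{n/2-1}+\sum_{i=n/2+1}^{n/2+k-1}\binom{n}{i}+\binom{n-1}{n/2+k}, & n\text{ even}.\end{cases} \] *)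

theory Defs
  imports Main "HOL-Library.Ramsey"
begin

text \<open>The family of all \<open>k\<close>-element subsets of \<open>{1..n}\<close> is the library's \<^term>\<open>nsets {1..n} k\<close>.\<close>

text \<open>The two members need not be distinct, so the empty set is never a member.\<close>

definition intersecting :: "'a set set \<Rightarrow> bool" where
  "intersecting \<F> \<longleftrightarrow> (\<forall>A\<in>\<F>. \<forall>B\<in>\<F>. A \<inter> B \<noteq> {})"

text \<open>Containment is as a not necessarily induced subposet: the lower two sets, or the upper two,
  may themselves be comparable, so a chain of four sets is excluded as well.\<close>

definition butterfly_free :: "'a set set \<Rightarrow> bool" where
  "butterfly_free \<F> \<longleftrightarrow>
     \<not> (\<exists>W\<in>\<F>. \<exists>X\<in>\<F>. \<exists>Y\<in>\<F>. \<exists>Z\<in>\<F>.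
          distinct [W, X, Y, Z] \<and> W \<subseteq> Y \<and> W \<subseteq> Z \<and> X \<subseteq> Y \<and> X \<subseteq> Z)"

text \<open>The subtractions on \<^typ>\<open>nat\<close> below do not truncate for \<open>n \<ge> 2\<close>, and the parity test makes the divisions exact.\<close>

definition Sigma_I :: "nat \<Rightarrow> nat \<Rightarrow> nat" where
  "Sigma_I n k =
     (if odd n then (\<Sum>i = (n + 1) div 2..(n + 1) div 2 + k - 1. n choose i)
      else ((n - 1) choose (n div 2 - 1))
         + (\<Sum>i = n div 2 + 1..n div 2 + k - 1. n choose i)
         + ((n - 1) choose (n div 2 + k)))"

text \<open>The extremal families \<open>\<H>\<^sub>0\<^sub>,\<^sub>n\<^sub>,\<^sub>2\<close> (for odd \<open>n\<close>) and \<open>\<H>\<^sub>x\<^sub>,\<^sub>n\<^sub>,\<^sub>2\<close> (for even \<open>n\<close> and \<open>x \<in> {1..n}\<close>).\<close>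

definition H_odd :: "nat \<Rightarrow> nat set set" where
  "H_odd n = nsets {1..n} (n div 2 + 1) \<union> nsets {1..n} (n div 2 + 2)"

definition H_even :: "nat \<Rightarrow> nat \<Rightarrow> nat set set" where
  "H_even x n =
     {F \<in> nsets {1..n} (n div 2). x \<in> F} \<union> nsets {1..n} (n div 2 + 1) \<union> {F \<in> nsets {1..n} (n div 2 + 2). x \<notin> F}"

end

theory Submission
  imports Defs Complex_Main "HOL-Combinatorics.Permutations"
begin

text \<open>
  The proof combines Katona's cycle method with a charging argument. A permutation \<open>p\<close> of \<open>{1..n}\<close>
  turns the arcs (cyclic intervals) into sets, and if an arc \<open>I\<close> is given the weight \<open>n choose card I\<close>,
  the arcs hit by a family \<open>\<F>\<close> have average weight \<open>n * card \<F>\<close>. If \<open>\<F>\<close> has no chain of three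
  sets, the arcs hit split into an antichain of minimal and one of maximal arcs. Each has at most
  \<open>n\<close> members, with equality only for a full level; as moreover at most one of two complementary
  arcs occurs, the weight on every single cycle is at most \<open>n\<close> times the claimed bound.

  In a butterfly-free family the middle \<open>M\<close> of a chain of three has exactly one member below it and
  one above it. For most \<open>p\<close> that map some arc to \<open>M\<close> neither of the two is an arc as well, so \<open>M\<close> is
  isolated on the cycle, counts as both minimal and maximal, and lowers the bound. This gain exceeds
  the loss from the rare \<open>p\<close> for which both are arcs, so an extremal family has no chain of three and
  is tight on every cycle. For even \<open>n\<close>, the complements of its \<open>(n/2 + 2)\<close>-sets then form an
  intersecting family that is tight for Erdos--Ko--Rado on every cycle, which makes it a star.

  The charging fails next to very small or very large sets. A singleton forces a star, which is too
  small. A set of size \<open>n\<close> or \<open>n - 1\<close> can be exchanged for a subset with one element less, unless so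
  few members avoid some point that the family is again too small; the exchange keeps the number of
  members, and the result is not extremal.
\<close>

text \<open>Once an arc is sent to a middle set of size j, the member below it is an arc for a share
  of at most 2/j of the permutations, the member above it for at most 2/(n - j), and both for at
  most 4/(j(n - j)). With m = floor(n/2) and \<delta> = (n choose (m + 2)), four times the cycle
  bound therefore changes by a negative amount on average as soon as 16 (n choose j) < 3 \<delta>
  (j(n - j) - 2n). The share 2/j needs a lower set of at least two points: a singleton inside an arc
  is always an arc, and dually for sets of size n - 1. For even n the obstacle is an antichain that
  fills a whole level, because a tight cycle carries only 2n - 2 arcs, not 2n. A full level consists
  of arcs longer than n/2, which costs weight elsewhere. When the maximal arcs fill level m + 1, up
  to seven isolated arcs have to be paid from a surplus of (m - 2) \<delta>, and 7 <= m - 2 amounts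
  to n >= 18.\<close>

declare One_nat_def [simp del]

section \<open>Permutations with prescribed images\<close>

lemma ex_permutes_image:
  assumes "finite M" "L \<subseteq> M" "L' \<subseteq> M" "card L = card L'"
  obtains q where "q permutes M" "q ` L = L'"
proof -
  have fin: "finite L" "finite L'" using assms finite_subset by blast+
  then obtain f where f: "bij_betw f L L'" using assms(4) finite_same_card_bij by blast
  have "card (M - L) = card (M - L')" using assms fin by (simp add: card_Diff_subset)
  then obtain g where g: "bij_betw g (M - L) (M - L')"
    using assms(1) finite_same_card_bij by (metis finite_Diff)
  define q where "q = (\<lambda>x. if x \<in> L then f x else if x \<in> M then g x else x)"
  have "bij_betw q L L'" using f by (simp add: q_def cong: bij_betw_cong)
  moreover have "bij_betw q (M - L) (M - L')"
    using g by (rule bij_betw_cong[THEN iffD1, rotated]) (simp add: q_def)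
  ultimately have "bij_betw q (L \<union> (M - L)) (L' \<union> (M - L'))"
    by (rule bij_betw_combine) blast
  then have "bij_betw q M M" using assms by (simp add: Un_absorb1)
  then have "q permutes M" by (rule bij_imp_permutes) (use assms in \<open>auto simp: q_def\<close>)
  moreover have "q ` L = L'" using \<open>bij_betw q L L'\<close> by (simp add: bij_betw_def)
  ultimately show ?thesis by (rule that)
qed

text \<open>All fibres \<open>X L'\<close> have the same size, since composing with a permutation of
  \<open>M\<close> that carries \<open>L1\<close> to \<open>L2\<close> embeds one into the other.
  \<open>P\<close> may be any set closed under such compositions, so the count still applies after
  further conditions have been imposed on the permutations.\<close>

lemma card_flag:
  fixes P :: "('b \<Rightarrow> 'a) set"
  assumes "finite P" "finite M" "L \<subseteq> M" "J \<subseteq> I" "card J = card L"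
    and P: "\<And>p. p \<in> P \<Longrightarrow> inj p \<and> p ` I = M"
    and cl: "\<And>p q. p \<in> P \<Longrightarrow> q permutes M \<Longrightarrow> q \<circ> p \<in> P"
  shows "card {p \<in> P. p ` J = L} * (card M choose card L) = card P"
proof -
  define K where "K = {L'. L' \<subseteq> M \<and> card L' = card L}"
  define X where "X L' = {p \<in> P. p ` J = L'}" for L'
  have finK: "finite K" using assms(2) unfolding K_def by simp
  have le: "card (X L1) \<le> card (X L2)" if "L1 \<in> K" "L2 \<in> K" for L1 L2
  proof -
    obtain q where q: "q permutes M" "q ` L1 = L2"
      using ex_permutes_image[of M L1 L2] assms(2) \<open>L1 \<in> K\<close> \<open>L2 \<in> K\<close> unfolding K_def by auto
    have "inj_on (\<lambda>p. q \<circ> p) (X L1)"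
      using permutes_inj[OF q(1)] by (auto simp: inj_on_def fun_eq_iff)
    moreover have "(\<lambda>p. q \<circ> p) ` X L1 \<subseteq> X L2"
      using q cl by (auto simp: X_def image_comp[symmetric])
    moreover have "finite (X L2)" using assms(1) by (simp add: X_def)
    ultimately show ?thesis by (rule card_inj_on_le)
  qed
  have LK: "L \<in> K" using assms(3) by (simp add: K_def)
  have PU: "P = (\<Union>L'\<in>K. X L')"
  proof -
    have "p ` J \<in> K" if "p \<in> P" for p
      using P[OF that] assms(4,5) by (auto simp: K_def card_image inj_on_subset)
    then show ?thesis by (auto simp: X_def)
  qed
  have "card (\<Union>L'\<in>K. X L') = (\<Sum>L'\<in>K. card (X L'))"
    by (rule card_UN_disjoint) (use finK assms(1) in \<open>auto simp: X_def\<close>)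
  then have "card P = (\<Sum>L'\<in>K. card (X L'))" using PU by simp
  also have "\<dots> = (\<Sum>L'\<in>K. card (X L))"
    using le LK by (intro sum.cong refl antisym) auto
  also have "\<dots> = card K * card (X L)" by simp
  also have "card K = card M choose card L" unfolding K_def using n_subsets[OF assms(2)] .
  finally show ?thesis by (simp add: X_def)
qed

lemma card_permutes_image:
  assumes "finite S" "I \<subseteq> S" "A \<subseteq> S" "card I = card A"
  shows "card {p. p permutes S \<and> p ` I = A} * (card S choose card A) = fact (card S)"
proof -
  have "card {p \<in> {p. p permutes S}. p ` I = A} * (card S choose card A) = card {p. p permutes S}"
    by (rule card_flag) (use assms in \<open>auto simp: finite_permutations permutes_inj permutes_image permutes_in_image intro: permutes_compose\<close>)
  then show ?thesis using assms(1) by (simp add: card_permutations)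
qed

section \<open>Sperner's theorem\<close>

definition antichain :: "'a set set \<Rightarrow> bool" where
  "antichain \<A> \<longleftrightarrow> (\<forall>A\<in>\<A>. \<forall>B\<in>\<A>. \<not> A \<subset> B)"

text \<open>The LYM argument: the initial segments \<open>I k\<close> of an enumeration form a
  chain, and the image of this chain under a permutation contains at most one member of an
  antichain. Each member is hit by at least \<open>fact (card S)\<close> over the middle binomial
  coefficient many permutations.\<close>

lemma sperner:
  assumes "finite S" "\<A> \<subseteq> Pow S" "antichain \<A>"
  shows "card \<A> \<le> card S choose (card S div 2)"
proof -
  obtain h where h: "bij_betw h {0..<card S} S" using ex_bij_betw_nat_finite[OF assms(1)] by blast
  define I where "I k = h ` {0..<k}" for k
  have I: "I k \<subseteq> S" "card (I k) = k" if "k \<le> card S" for k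
    using h that unfolding I_def
    by (auto simp: bij_betw_def intro!: trans[OF card_image] inj_on_subset[of h "{0..<card S}"])
  have Imono: "I k \<subseteq> I l" if "k \<le> l" for k l using that by (auto simp: I_def)
  define X where "X A = {p. p permutes S \<and> p ` I (card A) = A}" for A
  define c where "c = (card S choose (card S div 2))"
  have fin: "finite \<A>" using assms finite_subset by blast
  have cX: "fact (card S) \<le> c * card (X A)" if "A \<in> \<A>" for A
  proof -
    have A: "A \<subseteq> S" using that assms by auto
    then have "card A \<le> card S" by (rule card_mono[OF assms(1)])
    have "fact (card S) = card (X A) * (card S choose card A)"
      unfolding X_def using card_permutes_image[OF assms(1) I(1) A] I(2) \<open>card A \<le> card S\<close> by simp
    also have "\<dots> \<le> card (X A) * c" unfolding c_def by (simp add: binomial_maximum)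
    finally show ?thesis by (simp add: mult.commute)
  qed
  have disj: "X A \<inter> X B = {}" if "A \<in> \<A>" "B \<in> \<A>" "A \<noteq> B" for A B
  proof -
    have "False" if "p \<in> X A" "p \<in> X B" for p
    proof -
      have "A \<subseteq> B \<or> B \<subseteq> A"
      proof (cases "card A \<le> card B")
        case True
        then have "p ` I (card A) \<subseteq> p ` I (card B)" by (intro image_mono Imono)
        then show ?thesis using that by (simp add: X_def)
      next
        case False
        then have "p ` I (card B) \<subseteq> p ` I (card A)" by (intro image_mono Imono) simp
        then show ?thesis using that by (simp add: X_def)
      qed
      then show False using assms(3) \<open>A \<in> \<A>\<close> \<open>B \<in> \<A>\<close> \<open>A \<noteq> B\<close> by (auto simp: antichain_def)
    qed
    then show ?thesis by blast
  qed
  have finX: "finite (X A)" for A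
    unfolding X_def by (rule finite_subset[OF _ finite_permutations[OF assms(1)]]) auto
  have "card \<A> * fact (card S) = (\<Sum>A\<in>\<A>. fact (card S))" by simp
  also have "\<dots> \<le> (\<Sum>A\<in>\<A>. c * card (X A))" by (rule sum_mono) (rule cX)
  also have "\<dots> = c * card (\<Union>A\<in>\<A>. X A)"
    by (subst card_UN_disjoint) (use fin finX disj in \<open>auto simp: sum_distrib_left\<close>)
  also have "card (\<Union>A\<in>\<A>. X A) \<le> card {p. p permutes S}"
    by (rule card_mono) (auto simp: X_def finite_permutations assms(1))
  also have "\<dots> = fact (card S)" using assms(1) by (simp add: card_permutations)
  finally show ?thesis by (simp add: c_def)
qed

section \<open>Arcs of a cycle\<close>

text \<open>Starting points count from 0 and are read modulo \<open>n\<close>, with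
  \<open>Suc\<close> moving the residues into {1..n}. Since \<open>i\<close> may exceed
  \<open>n\<close>, shifts backwards can be written without subtraction below 0.\<close>

definition arc :: "nat \<Rightarrow> nat \<Rightarrow> nat \<Rightarrow> nat set" where
  "arc n i l = (\<lambda>t. Suc ((i + t) mod n)) ` {..<l}"

text \<open>The empty and the full arc are left out: the rest is closed under complements and has
  exactly \<open>n\<close> arcs of each length.\<close>

definition arcs :: "nat \<Rightarrow> nat set set" where
  "arcs n = {arc n i l |i l. i < n \<and> 1 \<le> l \<and> l < n}"

lemma inj_on_arc: "inj_on (\<lambda>t. Suc ((i + t) mod n)) {..<n}"
proof (rule linorder_inj_onI')
  fix s t assume st: "s \<in> {..<n}" "t \<in> {..<n}" "s < t"
  show "Suc ((i + s) mod n) \<noteq> Suc ((i + t) mod n)"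
  proof
    assume "Suc ((i + s) mod n) = Suc ((i + t) mod n)"
    then have "(i + t) mod n = (i + s) mod n" by simp
    then have "n dvd t - s" using st mod_eq_dvd_iff_nat[of "i + s" "i + t" n] by simp
    then show False using st by (auto dest: dvd_imp_le)
  qed
qed

lemma card_arc: "l \<le> n \<Longrightarrow> card (arc n i l) = l"
  unfolding arc_def by (subst card_image) (auto intro: inj_on_subset[OF inj_on_arc])

lemma arc_subset: "0 < n \<Longrightarrow> arc n i l \<subseteq> {1..n}"
  unfolding arc_def by (auto simp: Suc_le_eq)

lemma arc_full: "0 < n \<Longrightarrow> arc n i n = {1..n}"
  by (rule card_subset_eq) (simp_all add: card_arc arc_subset)

lemma arc_mod: "arc n (i mod n) l = arc n i l"
  unfolding arc_def by (simp add: mod_add_left_eq)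

text \<open>Offsets are measured from the common point \<open>i\<close>. While they stay below
  \<open>n\<close>, where the map is injective, inclusion and disjointness of arcs reduce to
  intervals of numbers.\<close>

lemma arc_add: "arc n (i + d) l = (\<lambda>t. Suc ((i + t) mod n)) ` {d..<d + l}"
proof -
  have "{d..<d + l} = (\<lambda>t. d + t) ` {..<l}" by (simp add: lessThan_atLeast0 image_add_atLeastLessThan add.commute)
  then show ?thesis by (simp add: arc_def image_image add.assoc)
qed

lemma arc_mono: "l \<le> l' \<Longrightarrow> arc n i l \<subseteq> arc n i l'"
  unfolding arc_def by auto

lemma arc_shift: "d + l \<le> l' \<Longrightarrow> arc n (i + d) l \<subseteq> arc n i l'"
  unfolding arc_add by (auto simp: arc_def)

lemma arc_disjoint:
  assumes "l \<le> d" "d + l' \<le> n"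
  shows "arc n i l \<inter> arc n (i + d) l' = {}"
proof -
  have "(\<lambda>t. Suc ((i + t) mod n)) ` ({..<l} \<inter> {d..<d + l'}) = arc n i l \<inter> arc n (i + d) l'"
    unfolding arc_add unfolding arc_def
    by (rule inj_on_image_Int[OF inj_on_arc]) (use assms in auto)
  moreover have "{..<l} \<inter> {d..<d + l'} = {}" using assms by auto
  ultimately show ?thesis by simp
qed

lemma arc_compl:
  assumes "0 < n" "l \<le> n"
  shows "{1..n} - arc n i l = arc n (i + l) (n - l)"
proof -
  have "{1..n} = arc n i l \<union> arc n (i + l) (n - l)"
    unfolding arc_full[OF assms(1), of i, symmetric] arc_add
    unfolding arc_def image_Un[symmetric] using assms(2) by (intro arg_cong[where f = "image _"]) auto
  then show ?thesis using arc_disjoint[of l l "n - l" n i] assms by auto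
qed

lemma arc_in_arcs: "1 \<le> l \<Longrightarrow> l < n \<Longrightarrow> arc n i l \<in> arcs n"
  unfolding arcs_def by (rule CollectI, rule exI[of _ "i mod n"], rule exI[of _ l]) (simp add: arc_mod)

lemma arcsE:
  assumes "I \<in> arcs n"
  obtains i where "i < n" "I = arc n i (card I)" "1 \<le> card I" "card I < n"
  using assms unfolding arcs_def by (auto simp: card_arc)

lemma finite_arcs: "finite (arcs n)"
proof -
  have "arcs n \<subseteq> (\<lambda>(i,l). arc n i l) ` ({..<n} \<times> {..<n})" unfolding arcs_def by auto
  then show ?thesis by (rule finite_subset) auto
qed

lemma arcs_subset: "I \<in> arcs n \<Longrightarrow> I \<subseteq> {1..n}"
  by (elim arcsE) (metis arc_subset less_le_trans less_imp_le_nat zero_less_one order_less_le_trans)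

lemma arcs_finite: "I \<in> arcs n \<Longrightarrow> finite I"
  using arcs_subset finite_subset by blast

lemma arcs_compl:
  assumes "I \<in> arcs n"
  shows "{1..n} - I \<in> arcs n"
proof -
  obtain i where i: "I = arc n i (card I)" "1 \<le> card I" "card I < n" using assms by (rule arcsE)
  then have "{1..n} - I = arc n (i + card I) (n - card I)" using arc_compl[of n "card I" i] by simp
  then show ?thesis using i arc_in_arcs[of "n - card I" n] by simp
qed

lemma arc_eq_iff:
  assumes "1 \<le> l" "l < n" "arc n i l = arc n j l"
  shows "i mod n = j mod n"
proof -
  have "Suc (i mod n) \<in> arc n j l" using assms unfolding assms(3)[symmetric] arc_def
    by (metis (no_types, lifting) add_0_right imageI lessThan_iff less_le_trans zero_less_one)
  then obtain t where t: "t < l" "i mod n = (j + t) mod n" unfolding arc_def by auto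
  have eq: "arc n j l = arc n (j + t) l" using t(2) assms(3) by (metis arc_mod)
  \<comment> \<open>Otherwise the point just past the end of the arc at \<open>j\<close> would lie
    in the arc at \<open>j + t\<close>, which is the same arc.\<close>
  have "t = 0"
  proof (rule ccontr)
    assume "t \<noteq> 0"
    then have "Suc ((j + l) mod n) \<in> arc n (j + t) l" unfolding arc_add using t by auto
    moreover have "Suc ((j + l) mod n) \<in> arc n (j + l) 1" unfolding arc_def by auto
    ultimately show False using arc_disjoint[of l l 1 n j] assms(2) eq by auto
  qed
  then show ?thesis using t by simp
qed

lemma arcs_level: "1 \<le> l \<Longrightarrow> l < n \<Longrightarrow> {I \<in> arcs n. card I = l} = (\<lambda>i. arc n i l) ` {..<n}"
  by (auto simp: arcs_def card_arc)

lemma inj_on_arc_start: "1 \<le> l \<Longrightarrow> l < n \<Longrightarrow> inj_on (\<lambda>i. arc n i l) {..<n}"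
  by (rule inj_onI) (auto dest: arc_eq_iff[rotated 2])

lemma card_arcs_level: "1 \<le> l \<Longrightarrow> l < n \<Longrightarrow> card {I \<in> arcs n. card I = l} = n"
  by (simp add: arcs_level card_image inj_on_arc_start)

text \<open>Arcs with a common starting point are nested, so an antichain has at most one arc for
  each starting point.\<close>

lemma antichain_arcs_inj:
  assumes "\<A> \<subseteq> arcs n" "antichain \<A>"
  obtains s where "inj_on s \<A>" "s ` \<A> \<subseteq> {..<n}" "\<And>I. I \<in> \<A> \<Longrightarrow> I = arc n (s I) (card I)"
proof -
  have "\<forall>I\<in>\<A>. \<exists>i. i < n \<and> I = arc n i (card I)" using assms(1) by (auto elim!: arcsE dest!: subsetD)
  then obtain s where s: "\<And>I. I \<in> \<A> \<Longrightarrow> s I < n \<and> I = arc n (s I) (card I)" by metis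
  have "inj_on s \<A>"
  proof (rule inj_onI)
    fix I J assume IJ: "I \<in> \<A>" "J \<in> \<A>" "s I = s J"
    then have "I \<subseteq> J \<or> J \<subseteq> I"
      using s[of I] s[of J] arc_mono[of "card I" "card J" n "s I"] arc_mono[of "card J" "card I" n "s I"]
      by (metis nat_le_linear)
    then show "I = J" using assms(2) IJ by (auto simp: antichain_def)
  qed
  then show ?thesis using s by (intro that) auto
qed

lemma card_antichain_arcs:
  assumes "\<A> \<subseteq> arcs n" "antichain \<A>"
  shows "card \<A> \<le> n"
  using antichain_arcs_inj[OF assms] card_inj_on_le[of _ \<A> "{..<n}"] by (metis card_lessThan finite_lessThan)

text \<open>With one arc per starting point, the length cannot drop from one starting point to the next,
  hence is constant around the cycle.\<close>

lemma full_antichain_arcs: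
  assumes "\<A> \<subseteq> arcs n" "antichain \<A>" "card \<A> = n" "0 < n"
  obtains l where "1 \<le> l" "l < n" "\<A> = {I \<in> arcs n. card I = l}"
proof -
  obtain s where s: "inj_on s \<A>" "s ` \<A> \<subseteq> {..<n}" "\<And>I. I \<in> \<A> \<Longrightarrow> I = arc n (s I) (card I)"
    using antichain_arcs_inj[OF assms(1,2)] by metis
  have "s ` \<A> = {..<n}" using s assms(3) by (intro card_subset_eq) (auto simp: card_image)
  then have "\<forall>i. \<exists>I\<in>\<A>. s I = i mod n" using assms(4) by (metis imageE lessThan_iff mod_less_divisor)
  then obtain f where f: "\<And>i. f i \<in> \<A> \<and> s (f i) = i mod n" by metis
  have farc: "f i = arc n i (card (f i))" for i using s(3)[of "f i"] f[of i] arc_mod by metis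
  have bd: "1 \<le> card (f i)" "card (f i) < n" for i using f[of i] assms(1) by (auto elim!: arcsE)
  have step: "card (f i) \<le> card (f (Suc i))" for i
  proof (rule ccontr)
    assume "\<not> ?thesis"
    then have lt: "card (f (Suc i)) < card (f i)" by simp
    have "arc n (Suc i) (card (f (Suc i))) \<subseteq> arc n i (card (f i))"
      using arc_shift[of 1 "card (f (Suc i))" "card (f i)" n i] lt by (simp add: Suc_eq_plus1)
    then have "f (Suc i) \<subseteq> f i" using farc by metis
    then have "f (Suc i) \<subset> f i" using lt by auto
    then show False using f assms(2) by (auto simp: antichain_def)
  qed
  have mono: "card (f i) \<le> card (f j)" if "i \<le> j" for i j
    by (rule lift_Suc_mono_le[of "\<lambda>i. card (f i)", OF step that])
  have "f n = f 0" using f[of n] f[of 0] s(1) by (auto simp: inj_on_def)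
  then have const: "card (f i) = card (f 0)" if "i \<le> n" for i
    using mono[of 0 i] mono[of i n] that by simp
  have "card I = card (f 0)" if "I \<in> \<A>" for I
  proof -
    have lt: "s I < n" using s(2) that by auto
    then have "s (f (s I)) = s I" using f by simp
    then have "f (s I) = I" using f s(1) that by (auto simp: inj_on_def)
    then show ?thesis using const[of "s I"] lt by simp
  qed
  then have "\<A> \<subseteq> {I \<in> arcs n. card I = card (f 0)}" using assms(1) by auto
  then have "\<A> = {I \<in> arcs n. card I = card (f 0)}"
    by (rule card_subset_eq[rotated]) (simp_all add: finite_arcs card_arcs_level bd assms(3))
  then show ?thesis using that bd by blast
qed

text \<open>A subarc starts at an offset inside \<open>I\<close> and cannot run past the end of
  \<open>I\<close>, because \<open>card I < n\<close> puts the next point outside. This leaves the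
  offsets from 0 to \<open>card I - l\<close>.\<close>

lemma card_subarcs:
  assumes "I \<in> arcs n" "l \<le> card I"
  shows "card {J \<in> arcs n. card J = l \<and> J \<subseteq> I} \<le> card I - l + 1"
proof -
  obtain i where i: "I = arc n i (card I)" "1 \<le> card I" "card I < n" using assms(1) by (rule arcsE)
  have "{J \<in> arcs n. card J = l \<and> J \<subseteq> I} \<subseteq> (\<lambda>t. arc n (i + t) l) ` {..card I - l}"
  proof
    fix J assume "J \<in> {J \<in> arcs n. card J = l \<and> J \<subseteq> I}"
    then have J: "J \<in> arcs n" "card J = l" "J \<subseteq> I" by auto
    then obtain b where b: "J = arc n b l" "1 \<le> l" "l < n" by (metis arcsE)
    have "Suc (b mod n) \<in> J" unfolding b arc_def using b(2) by (intro image_eqI[of _ _ 0]) auto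
    then have "Suc (b mod n) \<in> arc n i (card I)" using J i by auto
    then obtain t where t: "t < card I" "b mod n = (i + t) mod n" unfolding arc_def by auto
    have Jt: "J = arc n (i + t) l" using b t by (metis arc_mod)
    have "t + l \<le> card I"
    proof (rule ccontr)
      assume "\<not> ?thesis"
      then have "Suc ((i + card I) mod n) \<in> arc n (i + t) l" unfolding arc_add using t by auto
      moreover have "Suc ((i + card I) mod n) \<in> arc n (i + card I) 1" unfolding arc_def by auto
      ultimately show False using arc_disjoint[of "card I" "card I" 1 n i] i J Jt by auto
    qed
    then show "J \<in> (\<lambda>t. arc n (i + t) l) ` {..card I - l}" using Jt by auto
  qed
  then have "card {J \<in> arcs n. card J = l \<and> J \<subseteq> I} \<le> card {..card I - l}"
    by (rule surj_card_le[OF finite_atMost])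
  then show ?thesis by simp
qed

section \<open>The weight of a family of arcs\<close>

definition middle :: "'a set set \<Rightarrow> 'a set set" where
  "middle \<G> = {M \<in> \<G>. (\<exists>L\<in>\<G>. L \<subset> M) \<and> (\<exists>U\<in>\<G>. M \<subset> U)}"

definition isolated :: "'a set set \<Rightarrow> 'a set set" where
  "isolated \<G> = {M \<in> \<G>. \<not> (\<exists>A\<in>\<G>. A \<subset> M \<or> M \<subset> A)}"

definition minimals :: "'a set set \<Rightarrow> 'a set set" where
  "minimals \<G> = {M \<in> \<G>. \<not> (\<exists>L\<in>\<G>. L \<subset> M)}"

definition maximals :: "'a set set \<Rightarrow> 'a set set" where
  "maximals \<G> = {M \<in> \<G>. \<not> (\<exists>U\<in>\<G>. M \<subset> U)}"

definition level :: "'a set set \<Rightarrow> nat \<Rightarrow> 'a set set" where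
  "level \<G> l = {I \<in> \<G>. card I = l}"

definition binomial_weight :: "nat \<Rightarrow> 'a set set \<Rightarrow> real" where
  "binomial_weight n \<G> = (\<Sum>I\<in>\<G>. real (n choose card I))"

lemma antichain_minimals: "antichain (minimals \<G>)" and antichain_maximals: "antichain (maximals \<G>)"
  by (auto simp: antichain_def minimals_def maximals_def)

lemma ex_minimal:
  assumes "finite \<G>" "I \<in> \<G>"
  shows "\<exists>J\<in>minimals \<G>. J \<subseteq> I"
  using finite_has_minimal2[OF assms] by (force simp: minimals_def)

lemma ex_maximal:
  assumes "finite \<G>" "I \<in> \<G>"
  shows "\<exists>J\<in>maximals \<G>. I \<subseteq> J"
  using finite_has_maximal2[OF assms] by (force simp: maximals_def)

text \<open>Without a chain of three every member is minimal or maximal, and the isolated members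
  are those that are both.\<close>

lemma card_minimals_maximals:
  assumes "finite \<G>" "middle \<G> = {}"
  shows "card \<G> + card (isolated \<G>) = card (minimals \<G>) + card (maximals \<G>)"
proof -
  have "\<G> = minimals \<G> \<union> maximals \<G>" "isolated \<G> = minimals \<G> \<inter> maximals \<G>"
    using assms(2) by (auto simp: minimals_def maximals_def middle_def isolated_def)
  moreover have "finite (minimals \<G>)" "finite (maximals \<G>)" using assms(1) by (auto simp: minimals_def maximals_def)
  ultimately show ?thesis using card_Un_Int[of "minimals \<G>" "maximals \<G>"] by simp
qed

section \<open>Complementary arcs in an intersecting family\<close>

lemma inj_on_compl: "\<A> \<subseteq> Pow S \<Longrightarrow> inj_on (\<lambda>I. S - I) \<A>"
  by (rule inj_on_inverseI[of _ "\<lambda>I. S - I"]) (auto simp: double_diff)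

text \<open>Level \<open>l\<close> and the complements of level \<open>n - l\<close> are disjoint
  parts of the full level of \<open>n\<close> arcs, and exhaust it in the equality case. For
  \<open>l = n - l\<close> this bounds the middle level by \<open>n / 2\<close>.\<close>

lemma level_pair:
  assumes "\<G> \<subseteq> arcs n" "intersecting \<G>" "1 \<le> l" "l < n"
  shows "card (level \<G> l) + card (level \<G> (n - l)) \<le> n"
    and "card (level \<G> l) + card (level \<G> (n - l)) = n \<Longrightarrow> I \<in> arcs n \<Longrightarrow> card I = l \<Longrightarrow>
      I \<in> \<G> \<or> {1..n} - I \<in> \<G>"
proof -
  define C where "C = (\<lambda>I. {1..n} - I) ` level \<G> (n - l)"
  have fin: "finite \<G>" using assms(1) finite_arcs finite_subset by blast
  have sub: "level \<G> k \<subseteq> Pow {1..n}" for k using assms(1) arcs_subset by (fastforce simp: level_def)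
  have "card C = card (level \<G> (n - l))" unfolding C_def by (rule card_image[OF inj_on_compl[OF sub]])
  moreover have "level \<G> l \<inter> C = {}"
  proof -
    have "False" if I: "I \<in> level \<G> l" "I \<in> C" for I
    proof -
      obtain J where "J \<in> \<G>" "I = {1..n} - J" using I(2) by (auto simp: C_def level_def)
      moreover have "I \<in> \<G>" using I(1) by (simp add: level_def)
      ultimately have "J \<inter> ({1..n} - J) \<noteq> {}" using assms(2) by (auto simp: intersecting_def)
      then show False by auto
    qed
    then show ?thesis by blast
  qed
  moreover have "finite (level \<G> k)" for k using fin by (simp add: level_def)
  ultimately have eq: "card (level \<G> l \<union> C) = card (level \<G> l) + card (level \<G> (n - l))"
    unfolding C_def by (subst card_Un_disjoint) auto
  have "card ({1..n} - J) = l" if "J \<in> level \<G> (n - l)" for J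
    using that sub[of "n - l"] assms(4) by (subst card_Diff_subset) (auto simp: level_def intro: finite_subset)
  then have "level \<G> l \<union> C \<subseteq> {I \<in> arcs n. card I = l}"
    using assms(1) arcs_compl by (auto simp: level_def C_def)
  then have le: "card (level \<G> l \<union> C) \<le> n" and "card (level \<G> l \<union> C) = n \<Longrightarrow> level \<G> l \<union> C = {I \<in> arcs n. card I = l}"
    using card_mono[of "{I \<in> arcs n. card I = l}" "level \<G> l \<union> C"]
      card_subset_eq[of "{I \<in> arcs n. card I = l}" "level \<G> l \<union> C"]
      card_arcs_level[OF assms(3,4)] finite_arcs by auto
  then have full: "level \<G> l \<union> C = {I \<in> arcs n. card I = l}" if "card (level \<G> l) + card (level \<G> (n - l)) = n"
    using that eq by simp
  show "I \<in> \<G> \<or> {1..n} - I \<in> \<G>"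
    if "card (level \<G> l) + card (level \<G> (n - l)) = n" "I \<in> arcs n" "card I = l"
  proof -
    have "I \<in> level \<G> l \<union> C" using full that by blast
    then consider "I \<in> \<G>" | J where "J \<in> \<G>" "I = {1..n} - J" by (auto simp: level_def C_def)
    then show ?thesis
    proof cases
      case 2
      then have "{1..n} - I = J" using assms(1) arcs_subset by (auto simp: double_diff)
      then show ?thesis using 2 by simp
    qed simp
  qed
  show "card (level \<G> l) + card (level \<G> (n - l)) \<le> n" using le eq by simp
qed

text \<open>The arc of length \<open>l\<close> that starts right after \<open>J\<close> belongs to
  the full level, and it misses \<open>J\<close> unless the two lengths add up to more than
  \<open>n\<close>.\<close>

lemma full_level_intersecting:
  assumes "{I \<in> arcs n. card I = l} \<subseteq> \<G>" "\<G> \<subseteq> arcs n" "intersecting \<G>" "1 \<le> l" "l < n" "J \<in> \<G>"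
  shows "n < card J + l"
proof (rule ccontr)
  assume "\<not> ?thesis"
  obtain i where i: "J = arc n i (card J)" "1 \<le> card J" using assms by (metis arcsE subsetD)
  have "arc n (i + card J) l \<in> \<G>" using assms(1,4,5) by (auto simp: arc_in_arcs card_arc)
  moreover have "J \<inter> arc n (i + card J) l = {}"
    using arc_disjoint[of "card J" "card J" l n i] i \<open>\<not> _\<close> by simp
  ultimately show False using assms(3,6) by (auto simp: intersecting_def)
qed

section \<open>Weight bounds on a single cycle\<close>

lemma choose_mult_succ: "Suc k * (n choose Suc k) = (n - k) * (n choose k)"
  unfolding binomial_absorption binomial_absorb_comp ..

lemma binomial_weight_le:
  assumes "finite \<G>" "\<And>I. I \<in> \<G> \<Longrightarrow> real (n choose card I) \<le> c"
  shows "binomial_weight n \<G> \<le> real (card \<G>) * c"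
  unfolding binomial_weight_def by (rule sum_bounded_above) (rule assms)

lemma card_two_levels:
  assumes "finite \<G>" "k \<noteq> l"
  shows "card {I \<in> \<G>. card I = k \<or> card I = l} = card (level \<G> k) + card (level \<G> l)"
proof -
  have "{I \<in> \<G>. card I = k \<or> card I = l} = level \<G> k \<union> level \<G> l" by (auto simp: level_def)
  then show ?thesis using assms by (simp add: card_Un_disjoint level_def disjoint_iff)
qed

text \<open>Members of \<open>X\<close>, \<open>Y\<close>, \<open>Z\<close> weigh at most
  \<open>a\<close>, \<open>\<delta>\<close>, \<open>\<delta> - 1\<close>. There are at most
  \<open>n\<close> in \<open>X\<close>, and at most \<open>2 * n\<close> minus the number of
  isolated arcs altogether, so the best choice is \<open>n\<close> arcs in \<open>X\<close> and
  \<open>n\<close> in \<open>Y\<close>.\<close>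

lemma cycle_bound_odd:
  fixes m :: nat and \<G> :: "nat set set"
  defines "n \<equiv> 2 * m + 1"
  defines "\<delta> \<equiv> real (n choose (m + 2))"
  defines "\<beta> \<equiv> real n * real (n choose (m + 1)) + real n * \<delta>"
  assumes m: "2 \<le> m" and \<G>: "\<G> \<subseteq> arcs n" "intersecting \<G>" "middle \<G> = {}"
  shows "binomial_weight n \<G> + \<delta> * card (isolated \<G>) \<le> \<beta>"
    and "binomial_weight n \<G> = \<beta> \<Longrightarrow> card (level \<G> (m + 1)) + card (level \<G> m) = n \<and>
      card (level \<G> (m + 2)) + card (level \<G> (m - 1)) = n"
proof -
  define a where "a = real (n choose (m + 1))"
  define X where "X = {I \<in> \<G>. card I = m + 1 \<or> card I = m}"
  define Y where "Y = {I \<in> \<G>. card I = m + 2 \<or> card I = m - 1}"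
  define Z where "Z = \<G> - X - Y"
  have fin: "finite \<G>" using \<G>(1) finite_arcs finite_subset by blast
  have fins: "finite X" "finite Y" "finite Z" using fin by (auto simp: X_def Y_def Z_def)
  have part: "\<G> = (X \<union> Y) \<union> Z" "(X \<union> Y) \<inter> Z = {}" "X \<inter> Y = {}"
    using m by (auto simp: X_def Y_def Z_def)
  have cX: "card X = card (level \<G> (m + 1)) + card (level \<G> m)"
    unfolding X_def by (rule card_two_levels[OF fin]) simp
  have cY: "card Y = card (level \<G> (m + 2)) + card (level \<G> (m - 1))"
    unfolding Y_def by (rule card_two_levels[OF fin]) simp
  have X: "card X \<le> n" using level_pair(1)[OF \<G>(1,2), of "m + 1"] cX m by (simp add: n_def)
  have Y: "card Y \<le> n" 
  proof -
    have "n - (m + 2) = m - 1" "m + 2 < n" using m by (auto simp: n_def)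
    then show ?thesis using level_pair(1)[OF \<G>(1,2), of "m + 2"] cY by simp
  qed
  have T: "card X + card Y + card Z + card (isolated \<G>) \<le> 2 * n"
  proof -
    have "card \<G> = card X + card Y + card Z"
      using fins part by (metis card_Un_disjoint finite_UnI)
    moreover have "card (minimals \<G>) \<le> n" "card (maximals \<G>) \<le> n"
      by (rule card_antichain_arcs[OF _ antichain_minimals], use \<G>(1) in \<open>auto simp: minimals_def\<close>)
         (rule card_antichain_arcs[OF _ antichain_maximals], use \<G>(1) in \<open>auto simp: maximals_def\<close>)
    ultimately show ?thesis using card_minimals_maximals[OF fin \<G>(3)] by simp
  qed
  have sym: "n choose m = n choose (m + 1)" "n choose (m - 1) = n choose (m + 2)"
    using binomial_symmetric[of m n] binomial_symmetric[of "m - 1" n] m by (simp_all add: n_def)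
  have lt: "\<delta> < a"
    unfolding \<delta>_def a_def using binomial_strict_mono[of "m - 1" m n] sym m by (simp add: n_def)
  have "0 < n choose (m + 2)" using m by (simp add: n_def)
  then have \<delta>pos: "1 \<le> \<delta>" unfolding \<delta>_def by linarith
  \<comment> \<open>The binomial coefficients are integers, so a strict inequality costs a full
    unit; this unit forces \<open>z = 0\<close> in the equality case.\<close>
  have wZ: "real (n choose card I) \<le> \<delta> - 1" if "I \<in> Z" for I
  proof -
    have "card I < m - 1 \<or> m + 2 < card I" using that by (auto simp: Z_def X_def Y_def)
    moreover have "card I < n" using that \<G>(1) by (auto simp: Z_def elim!: arcsE)
    ultimately have "n choose card I < n choose (m + 2)"
      using binomial_strict_mono[of "card I" "m - 1" n] binomial_strict_antimono[of "m + 2" "card I" n] sym m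
      by (auto simp: n_def)
    then show ?thesis by (simp add: \<delta>_def)
  qed
  have wX: "real (n choose card I) \<le> a" if "I \<in> X" for I
    using that sym unfolding X_def a_def by (metis (mono_tags, lifting) mem_Collect_eq order_refl)
  have wY: "real (n choose card I) \<le> \<delta>" if "I \<in> Y" for I
    using that sym unfolding Y_def \<delta>_def by (metis (mono_tags, lifting) mem_Collect_eq order_refl)
  have "binomial_weight n \<G> = binomial_weight n X + binomial_weight n Y + binomial_weight n Z"
    unfolding binomial_weight_def using fins part by (metis (no_types, lifting) finite_UnI sum.union_disjoint)
  also have "\<dots> \<le> card X * a + card Y * \<delta> + card Z * (\<delta> - 1)"
    by (intro add_mono binomial_weight_le fins wX wY wZ)
  finally have wt: "binomial_weight n \<G> \<le> card X * a + card Y * \<delta> + card Z * (\<delta> - 1)" .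
  define x y z t where "x = real (card X)" and "y = real (card Y)" and "z = real (card Z)" and "t = real (card (isolated \<G>))"
  have nn: "x \<ge> 0" "y \<ge> 0" "z \<ge> 0" "t \<ge> 0" by (auto simp: x_def y_def z_def t_def)
  have r: "x \<le> n" "y \<le> n" "x + y + z + t \<le> 2 * n" "binomial_weight n \<G> \<le> x * a + y * \<delta> + z * (\<delta> - 1)"
    using X Y T wt by (auto simp: x_def y_def z_def t_def)
  \<comment> \<open>The weight \<open>x * a + (y + z) * \<delta>\<close> is split into
    \<open>x * (a - \<delta>)\<close> and \<open>(x + y + z) * \<delta>\<close>, which are bounded
    separately.\<close>
  have 1: "x * (a - \<delta>) \<le> n * (a - \<delta>)" using r lt by (intro mult_right_mono) auto
  have 2: "(x + y + z + t) * \<delta> \<le> 2 * n * \<delta>" using r \<delta>pos by (intro mult_right_mono) auto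
  show "binomial_weight n \<G> + \<delta> * card (isolated \<G>) \<le> \<beta>"
    using 1 2 r(4) nn unfolding \<beta>_def t_def[symmetric] a_def[symmetric] by (simp add: algebra_simps)
  show "card (level \<G> (m + 1)) + card (level \<G> m) = n \<and> card (level \<G> (m + 2)) + card (level \<G> (m - 1)) = n"
    if "binomial_weight n \<G> = \<beta>"
  proof -
    have "n * a + n * \<delta> \<le> x * a + y * \<delta> + z * (\<delta> - 1)"
      using that r(4) unfolding \<beta>_def a_def[symmetric] by simp
    then have e: "(n - x) * (a - \<delta>) + (2 * n - x - y - z) * \<delta> + z \<le> 0" by (simp add: algebra_simps)
    have p: "(n - x) * (a - \<delta>) \<ge> 0" "(2 * n - x - y - z) * \<delta> \<ge> 0" using r nn lt \<delta>pos by auto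
    then have "(n - x) * (a - \<delta>) = 0" "(2 * n - x - y - z) * \<delta> = 0" "z = 0" using e nn by linarith+
    then have "x = n" "y = n" using lt \<delta>pos by auto
    then show ?thesis using cX cY by (simp add: x_def y_def)
  qed
qed

text \<open>The factor \<open>3/4\<close> is what remains of \<open>t\<close> isolated arcs when a full level leaves room for
  \<open>2 * n - t\<close> instead of \<open>2 * n - 2 - t\<close> arcs: there \<open>t \<ge> 8\<close> may be assumed, and \<open>t - 2 \<ge> 3 * t / 4\<close>.\<close>

lemma cycle_bound_even:
  fixes m :: nat and \<G> :: "nat set set"
  defines "n \<equiv> 2 * m"
  defines "\<delta> \<equiv> real (n choose (m + 2))"
  defines "\<beta> \<equiv> real m * real (n choose m) + real n * real (n choose (m + 1)) + (real m - 2) * \<delta>"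
  assumes m: "9 \<le> m" and \<G>: "\<G> \<subseteq> arcs n" "intersecting \<G>" "middle \<G> = {}"
  shows "4 * binomial_weight n \<G> + 3 * \<delta> * card (isolated \<G>) \<le> 4 * \<beta>"
    and "binomial_weight n \<G> = \<beta> \<Longrightarrow> card (level \<G> m) + card (level \<G> m) = n \<and>
      card (level \<G> (m + 1)) + card (level \<G> (m - 1)) = n \<and>
      card (level \<G> (m + 2)) + card (level \<G> (m - 2)) = m - 2"
proof -
  define a where "a = real (n choose m)"
  define b where "b = real (n choose (m + 1))"
  define V where "V = {I \<in> \<G>. card I = m}"
  define X where "X = {I \<in> \<G>. card I = m + 1 \<or> card I = m - 1}"
  define Y where "Y = {I \<in> \<G>. card I = m + 2 \<or> card I = m - 2}"
  define Z where "Z = \<G> - V - X - Y"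
  have fin: "finite \<G>" using \<G>(1) finite_arcs finite_subset by blast
  have fins: "finite V" "finite X" "finite Y" "finite Z" using fin by (auto simp: V_def X_def Y_def Z_def)
  have part: "\<G> = ((V \<union> X) \<union> Y) \<union> Z" "((V \<union> X) \<union> Y) \<inter> Z = {}" "(V \<union> X) \<inter> Y = {}" "V \<inter> X = {}"
    using m by (auto simp: V_def X_def Y_def Z_def)
  have cV: "card V = card (level \<G> m)" by (simp add: V_def level_def)
  have cX: "card X = card (level \<G> (m + 1)) + card (level \<G> (m - 1))"
    unfolding X_def by (rule card_two_levels[OF fin]) simp
  have cY: "card Y = card (level \<G> (m + 2)) + card (level \<G> (m - 2))"
    unfolding Y_def by (rule card_two_levels[OF fin]) simp
  have V: "card V \<le> m" using level_pair(1)[OF \<G>(1,2), of m] cV m by (simp add: n_def)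
  have X: "card X \<le> n" using level_pair(1)[OF \<G>(1,2), of "m + 1"] cX m by (simp add: n_def)
  have T: "card \<G> = card V + card X + card Y + card Z"
    using fins part by (metis card_Un_disjoint finite_UnI)
  have lohi: "card (minimals \<G>) \<le> n" "card (maximals \<G>) \<le> n"
    by (rule card_antichain_arcs[OF _ antichain_minimals], use \<G>(1) in \<open>auto simp: minimals_def\<close>)
       (rule card_antichain_arcs[OF _ antichain_maximals], use \<G>(1) in \<open>auto simp: maximals_def\<close>)
  note Tlohi = card_minimals_maximals[OF fin \<G>(3)]
  have sym: "n choose (m - 1) = n choose (m + 1)" "n choose (m - 2) = n choose (m + 2)"
    using binomial_symmetric[of "m - 1" n] binomial_symmetric[of "m - 2" n] m by (simp_all add: n_def)
  have lt: "\<delta> < b" "b < a"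
    unfolding \<delta>_def b_def a_def using binomial_strict_mono[of "m - 1" m n]
      binomial_strict_mono[of "m - 2" "m - 1" n] sym m by (simp_all add: n_def)
  have "0 < n choose (m + 2)" using m by (simp add: n_def)
  then have \<delta>pos: "1 \<le> \<delta>" unfolding \<delta>_def by linarith
  have \<delta>b: "(real m + 2) * \<delta> = (real m - 1) * b"
  proof -
    have "Suc (m + 1) = m + 2" by simp
    then have "(m + 2) * (n choose (m + 2)) = (n - (m + 1)) * (n choose (m + 1))"
      using choose_mult_succ[of "m + 1" n] by metis
    then have "real (m + 2) * real (n choose (m + 2)) = real (n - (m + 1)) * real (n choose (m + 1))"
      by (metis of_nat_mult)
    moreover have "real (n - (m + 1)) = real m - 1" using m by (simp add: n_def)
    ultimately show ?thesis by (simp only: \<delta>_def b_def of_nat_add of_nat_numeral)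
  qed
  have wZ: "real (n choose card I) \<le> \<delta> - 1" if "I \<in> Z" for I
  proof -
    have "card I < m - 2 \<or> m + 2 < card I" using that by (auto simp: Z_def V_def X_def Y_def)
    moreover have "card I < n" using that \<G>(1) by (auto simp: Z_def elim!: arcsE)
    ultimately have "n choose card I < n choose (m + 2)"
      using binomial_strict_mono[of "card I" "m - 2" n] binomial_strict_antimono[of "m + 2" "card I" n] sym m
      by (auto simp: n_def)
    then show ?thesis by (simp add: \<delta>_def)
  qed
  have wV: "real (n choose card I) \<le> a" if "I \<in> V" for I
    using that unfolding V_def a_def by (metis (mono_tags, lifting) mem_Collect_eq order_refl)
  have wX: "real (n choose card I) \<le> b" if "I \<in> X" for I
    using that sym unfolding X_def b_def by (metis (mono_tags, lifting) mem_Collect_eq order_refl)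
  have wY: "real (n choose card I) \<le> \<delta>" if "I \<in> Y" for I
    using that sym unfolding Y_def \<delta>_def by (metis (mono_tags, lifting) mem_Collect_eq order_refl)
  have "binomial_weight n \<G> = binomial_weight n V + binomial_weight n X + binomial_weight n Y + binomial_weight n Z"
    unfolding binomial_weight_def using fins part by (metis (no_types, lifting) finite_UnI sum.union_disjoint)
  also have "\<dots> \<le> card V * a + card X * b + card Y * \<delta> + card Z * (\<delta> - 1)"
    by (intro add_mono binomial_weight_le fins wV wX wY wZ)
  finally have wt: "binomial_weight n \<G> \<le> card V * a + card X * b + card Y * \<delta> + card Z * (\<delta> - 1)" .
  define v x y z t where "v = real (card V)" and "x = real (card X)" and "y = real (card Y)"
    and "z = real (card Z)" and "t = real (card (isolated \<G>))"
  have nn: "v \<ge> 0" "x \<ge> 0" "y \<ge> 0" "z \<ge> 0" "t \<ge> 0" by (auto simp: v_def x_def y_def z_def t_def)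
  have r: "v \<le> m" "x \<le> 2 * m" "binomial_weight n \<G> \<le> v * a + x * b + y * \<delta> + z * (\<delta> - 1)" "real n = 2 * m"
    using V X wt by (auto simp: v_def x_def y_def z_def n_def)
  have tot: "v + x + y + z + t \<le> 4 * m"
    using Tlohi T lohi by (simp add: v_def x_def y_def z_def t_def n_def)
  have mr: "real m \<ge> 9" using m by simp
  have 1: "v * (a - \<delta>) \<le> m * (a - \<delta>)" "x * (b - \<delta>) \<le> 2 * m * (b - \<delta>)"
    using r lt by (intro mult_right_mono; auto)+
  \<comment> \<open>The coefficient \<open>m - 2\<close> is what remains of \<open>4 * m - 2\<close>
    arcs after \<open>m\<close> arcs of size \<open>m\<close> and \<open>2 * m\<close> arcs of sizes
    \<open>m - 1\<close> and \<open>m + 1\<close>.\<close>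
  have \<beta>: "\<beta> = real m * a + 2 * real m * b + (real m - 2) * \<delta>"
    using r(4) m by (simp add: \<beta>_def a_def b_def)
  have mb: "m * b < m * a" using lt mr by simp
  have m\<delta>: "(real m + 2) * \<delta> < m * b" unfolding \<delta>b using lt \<delta>pos by (simp add: algebra_simps)
  \<comment> \<open>\<open>c\<close> is the allowance above \<open>4 * m - 2 - t\<close> arcs: 0 if
    neither antichain is full, 2 in general.\<close>
  have few: "binomial_weight n \<G> + (t - c) * \<delta> + z \<le> \<beta>" if "v + x + y + z + t + 2 \<le> 4 * m + c" for c :: real
  proof -
    have "(v + x + y + z + t + 2 - c) * \<delta> \<le> 4 * m * \<delta>" using that \<delta>pos by (intro mult_right_mono) auto
    then show ?thesis using 1 r(3) unfolding \<beta> by (simp add: algebra_simps)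
  qed
  \<comment> \<open>\<open>strict\<close> collects the cases with a full antichain and fewer than 8
    isolated arcs; its strict inequality keeps them out of the equality case.\<close>
  consider (notfull) "v + x + y + z + t + 2 \<le> 4 * m" | (strict) "binomial_weight n \<G> + t * \<delta> \<le> \<beta>" "binomial_weight n \<G> < \<beta>" | (many) "8 \<le> t"
  proof (cases "8 \<le> t")
    case False
    consider "card (minimals \<G>) < n" "card (maximals \<G>) < n" | "card (minimals \<G>) = n" | "card (maximals \<G>) = n"
      using lohi by linarith
    then show ?thesis
    proof cases
      case 1
      then have "card V + card X + card Y + card Z + card (isolated \<G>) + 2 \<le> 4 * m"
        using Tlohi T by (simp add: n_def)
      then have "v + x + y + z + t + 2 \<le> 4 * m" by (simp add: v_def x_def y_def z_def t_def)
      then show ?thesis by (rule that)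
    next
      case 2
      obtain l where l: "1 \<le> l" "l < n" "minimals \<G> = {I \<in> arcs n. card I = l}"
        by (rule full_antichain_arcs[OF _ antichain_minimals 2]) (use \<G>(1) m in \<open>auto simp: minimals_def n_def\<close>)
      then have sub: "{I \<in> arcs n. card I = l} \<subseteq> \<G>" by (auto simp: minimals_def)
      have "minimals \<G> \<noteq> {}" using 2 l(2) by (metis card.empty not_less_zero)
      then obtain J where "J \<in> minimals \<G>" by blast
      then have J: "J \<in> \<G>" "card J = l" using l(3) by (auto simp: minimals_def)
      then have ll: "n < l + l" using full_level_intersecting[OF sub \<G>(1,2) l(1,2)] by auto
      \<comment> \<open>Every member contains a minimal one, which is longer than \<open>m\<close>;
        so the heaviest level is empty and the summand \<open>m * a\<close> of
        \<open>\<beta>\<close> is not collected.\<close>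
      have "card I \<noteq> m" if I: "I \<in> \<G>" for I
      proof -
        obtain J where "J \<in> minimals \<G>" "J \<subseteq> I" using ex_minimal[OF fin I] by auto
        then have "l \<le> card I" using l card_mono[of I J] I \<G>(1) arcs_finite[of I n] by auto
        then show ?thesis using ll by (simp add: n_def)
      qed
      then have "V = {}" by (auto simp: V_def)
      then have "v = 0" by (simp add: v_def)
      moreover have "(v + x + y + z + t) * \<delta> \<le> 4 * m * \<delta>" using tot \<delta>pos by (intro mult_right_mono) auto
      ultimately have "binomial_weight n \<G> + t * \<delta> \<le> 2 * m * b + 2 * m * \<delta>"
        using 1(2) r(3) nn by (simp add: algebra_simps)
      also have "\<dots> < \<beta>" unfolding \<beta> using m\<delta> mb by (simp add: algebra_simps)
      finally show ?thesis using nn \<delta>pos by (intro that(2)) (auto intro: le_less_trans[rotated])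
    next
      case 3
      obtain l where l: "1 \<le> l" "l < n" "maximals \<G> = {I \<in> arcs n. card I = l}"
        by (rule full_antichain_arcs[OF _ antichain_maximals 3]) (use \<G>(1) m in \<open>auto simp: maximals_def n_def\<close>)
      then have sub: "{I \<in> arcs n. card I = l} \<subseteq> \<G>" by (auto simp: maximals_def)
      have "maximals \<G> \<noteq> {}" using 3 l(2) by (metis card.empty not_less_zero)
      then obtain J where "J \<in> maximals \<G>" by blast
      then have J: "J \<in> \<G>" "card J = l" using l(3) by (auto simp: maximals_def)
      then have ll: "n < l + l" using full_level_intersecting[OF sub \<G>(1,2) l(1,2)] by auto
      have le: "card I \<le> l" "n < card I + l" if I: "I \<in> \<G>" for I
      proof -
        obtain J where "J \<in> maximals \<G>" "I \<subseteq> J" using ex_maximal[OF fin I] by auto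
        then show "card I \<le> l" using l card_mono[of J I] arcs_finite[of J n] by auto
        show "n < card I + l" using full_level_intersecting[OF sub \<G>(1,2) l(1,2) I] .
      qed
      show ?thesis
      proof (cases "l = m + 1")
        case True
        have "card I = m \<or> card I = m + 1" if "I \<in> \<G>" for I
          using le[OF that] True by (auto simp: n_def)
        then have "Y = {}" "Z = {}" using m by (force simp: Y_def, force simp: Z_def V_def X_def)
        then have "binomial_weight n \<G> \<le> v * a + x * b" using r(3) by (simp add: y_def z_def)
        also have "\<dots> \<le> m * a + 2 * m * b" using r lt \<delta>pos by (intro add_mono mult_right_mono) auto
        finally have "binomial_weight n \<G> \<le> m * a + 2 * m * b" .
        \<comment> \<open>The summand \<open>(m - 2) * \<delta>\<close> of \<open>\<beta>\<close> is
          still free and pays for the isolated arcs: \<open>7 \<le> m - 2\<close> by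
          \<open>9 \<le> m\<close>.\<close>
        moreover have "t \<le> 7" using \<open>\<not> 8 \<le> t\<close> by (simp add: t_def)
        then have "t * \<delta> \<le> (real m - 2) * \<delta>" using mr \<delta>pos by (intro mult_right_mono) auto
        moreover have "0 < (real m - 2) * \<delta>" using mr \<delta>pos by simp
        ultimately show ?thesis by (intro that(2); unfold \<beta>; linarith)
      next
        case False
        \<comment> \<open>All \<open>n\<close> maximal arcs are longer than \<open>m + 1\<close> and
          weigh at most \<open>\<delta>\<close>, so the heavier arcs share the other
          \<open>2 * m\<close> places.\<close>
        then have "maximals \<G> \<subseteq> Y \<union> Z" using ll l by (auto simp: n_def Y_def Z_def V_def X_def maximals_def)
        then have "n \<le> card (Y \<union> Z)" using 3 card_mono[of "Y \<union> Z" "maximals \<G>"] fins by auto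
        also have "\<dots> \<le> card Y + card Z" by (rule card_Un_le)
        finally have yz: "2 * real m \<le> y + z" by (simp add: y_def z_def n_def)
        have "v * (a - b) \<le> m * (a - b)" using r lt by (intro mult_right_mono) auto
        moreover have "(v + x) * b \<le> (4 * m - t - (y + z)) * b" using tot lt \<delta>pos by (intro mult_right_mono) auto
        moreover have "(y + z - 2 * m) * (b - \<delta>) \<ge> 0" using yz lt by simp
        moreover have "t * (b - \<delta>) \<ge> 0" using nn lt by simp
        ultimately have "binomial_weight n \<G> + t * \<delta> \<le> m * a + m * b + 2 * m * \<delta>"
          using r(3) nn by (simp add: algebra_simps)
        also have "\<dots> < \<beta>" unfolding \<beta> using m\<delta> by (simp add: algebra_simps)
        finally show ?thesis using nn \<delta>pos by (intro that(2)) (auto simp: add_nonneg_nonneg intro: le_less_trans[rotated])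
      qed
    qed
  qed (rule that)
  note cs = this
  have t\<delta>: "t * \<delta> \<ge> 0" using nn \<delta>pos by simp
  have dt: "3 * \<delta> * t = 3 * (t * \<delta>)" by simp
  from cs have "4 * binomial_weight n \<G> + 3 * \<delta> * t \<le> 4 * \<beta>"
  proof cases
    case notfull
    then have "binomial_weight n \<G> + t * \<delta> + z \<le> \<beta>" using few[of 0] by simp
    then show ?thesis using t\<delta> nn unfolding dt by linarith
  next
    case strict
    then show ?thesis using t\<delta> unfolding dt by linarith
  next
    case many
    have "8 * \<delta> \<le> t * \<delta>" using many \<delta>pos by (intro mult_right_mono) auto
    moreover have "binomial_weight n \<G> + (t * \<delta> - 2 * \<delta>) + z \<le> \<beta>" using few[of 2] tot by (simp add: left_diff_distrib)
    ultimately show ?thesis using nn unfolding dt by linarith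
  qed
  then show "4 * binomial_weight n \<G> + 3 * \<delta> * card (isolated \<G>) \<le> 4 * \<beta>" by (simp add: t_def)
  show "card (level \<G> m) + card (level \<G> m) = n \<and>
      card (level \<G> (m + 1)) + card (level \<G> (m - 1)) = n \<and>
      card (level \<G> (m + 2)) + card (level \<G> (m - 2)) = m - 2" if eq: "binomial_weight n \<G> = \<beta>"
    using cs
  proof cases
    case strict
    then show ?thesis using eq t\<delta> by simp
  next
    case many
    have "8 * \<delta> \<le> t * \<delta>" using many \<delta>pos by (intro mult_right_mono) auto
    moreover have "binomial_weight n \<G> + (t * \<delta> - 2 * \<delta>) + z \<le> \<beta>" using few[of 2] tot by (simp add: left_diff_distrib)
    ultimately show ?thesis using nn eq \<delta>pos by linarith
  next
    case notfull
    have "m * a + 2 * m * b + (real m - 2) * \<delta> \<le> v * a + x * b + y * \<delta> + z * (\<delta> - 1)"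
      using eq r(3) unfolding \<beta> by simp
    then have e: "(m - v) * (a - \<delta>) + (2 * m - x) * (b - \<delta>) + (4 * real m - 2 - v - x - y - z) * \<delta> + z \<le> 0"
      by (simp add: algebra_simps)
    have p: "(m - v) * (a - \<delta>) \<ge> 0" "(2 * m - x) * (b - \<delta>) \<ge> 0" "(4 * real m - 2 - v - x - y - z) * \<delta> \<ge> 0"
      using r nn lt \<delta>pos notfull by auto
    then have "(m - v) * (a - \<delta>) = 0" "(2 * m - x) * (b - \<delta>) = 0" "(4 * real m - 2 - v - x - y - z) * \<delta> = 0" "z = 0"
      using e nn by linarith+
    then have "v = real m" "x = 2 * real m" "y = real m - 2" using lt \<delta>pos by auto
    then show ?thesis using cV cX cY m by (simp add: v_def x_def y_def n_def)
  qed
qed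

section \<open>Averaging over permutations\<close>

lemma double_choose_2: "2 * (n choose 2) = n * (n - 1)"
  using binomial_absorption[of 1 n] by (simp add: choose_one)

text \<open>An arc of \<open>j\<close> points has \<open>j - l + 1\<close> subarcs of length
  \<open>l\<close> among \<open>j choose l\<close> subsets of that size, a share of at most
  \<open>2 / j\<close>. For \<open>l = j - 1\<close> this is an equality; for \<open>l = 1\<close>
  and \<open>j > 2\<close> it would fail, every point being an arc.\<close>

lemma double_choose_ge:
  assumes "2 \<le> l" "l < j"
  shows "(j - l + 1) * j \<le> 2 * (j choose l)"
proof (cases "l = j - 1")
  case True
  have "j choose (j - 1) = j" using assms binomial_symmetric[of 1 j] by (simp add: choose_one)
  then show ?thesis using True assms by simp
next
  case False
  have "j choose 2 \<le> j choose l"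
  proof (cases "2 * l \<le> j")
    case True
    then show ?thesis using assms by (intro binomial_mono)
  next
    case False
    then have "j choose 2 \<le> j choose (j - l)" using \<open>l \<noteq> j - 1\<close> assms by (intro binomial_mono) auto
    then show ?thesis using assms binomial_symmetric[of l j] by simp
  qed
  moreover note double_choose_2[of j]
  moreover have "(j - l + 1) * j \<le> j * (j - 1)"
    unfolding mult.commute[of j "j - 1"] using assms False by (intro mult_right_mono) auto
  ultimately show ?thesis by linarith
qed

section \<open>Pulling a family back along a permutation\<close>

definition trace :: "nat \<Rightarrow> (nat \<Rightarrow> nat) \<Rightarrow> nat set set \<Rightarrow> nat set set" where
  "trace n p \<F> = {I \<in> arcs n. p ` I \<in> \<F>}"

lemma trace_subset: "trace n p \<F> \<subseteq> arcs n"
  by (auto simp: trace_def)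

lemma finite_trace: "finite (trace n p \<F>)"
  using trace_subset finite_arcs by (rule finite_subset)

lemma permutes_card_image: "p permutes S \<Longrightarrow> card (p ` I) = card I"
  by (rule card_image) (meson inj_on_subset permutes_inj subset_UNIV)

lemma permutes_image_psubset: "p permutes S \<Longrightarrow> p ` A \<subset> p ` B \<longleftrightarrow> A \<subset> B"
  by (simp add: inj_image_subset_iff permutes_inj psubset_eq inj_image_eq_iff)

lemma permutes_compl_image: "p permutes S \<Longrightarrow> p ` (S - A) = S - p ` A"
  by (simp add: image_set_diff permutes_inj permutes_image)

lemma intersecting_trace:
  assumes "p permutes {1..n}" "intersecting \<F>"
  shows "intersecting (trace n p \<F>)"
  using assms unfolding intersecting_def trace_def
  by (metis (no_types, lifting) image_Int image_empty mem_Collect_eq permutes_inj)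

text \<open>Pairs of a permutation and an arc are grouped by the image set, then by the arc. The
  summand may depend on \<open>p\<close>, because it will be the excess of an arc within a whole
  trace.\<close>

lemma sum_trace_swap:
  fixes \<phi> :: "(nat \<Rightarrow> nat) \<Rightarrow> nat set \<Rightarrow> real"
  assumes "finite \<M>"
  shows "(\<Sum>p | p permutes {1..n}. \<Sum>I\<in>trace n p \<M>. \<phi> p I) =
    (\<Sum>A\<in>\<M>. \<Sum>I | I \<in> arcs n \<and> card I = card A. \<Sum>p | p permutes {1..n} \<and> p ` I = A. \<phi> p I)"
proof -
  have fP: "finite {p. p permutes {1..n}}" by (simp add: finite_permutations)
  have fP': "finite {p. p permutes {1..n} \<and> p ` I = A}" for I A
    by (rule finite_subset[OF _ fP]) auto
  have fI: "finite {I \<in> arcs n. card I = k}" for k using finite_arcs by simp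
  have "(\<Sum>p | p permutes {1..n}. \<Sum>I\<in>trace n p \<M>. \<phi> p I) =
      (\<Sum>(p, I)\<in>(SIGMA p:{p. p permutes {1..n}}. trace n p \<M>). \<phi> p I)"
    by (rule sum.Sigma) (use fP finite_trace in auto)
  also have "\<dots> = (\<Sum>(A, I, p)\<in>(SIGMA A:\<M>. SIGMA I:{I \<in> arcs n. card I = card A}. {p. p permutes {1..n} \<and> p ` I = A}). \<phi> p I)"
    by (rule sum.reindex_bij_witness[of _ "\<lambda>(A, I, p). (p, I)" "\<lambda>(p, I). (p ` I, I, p)"])
      (auto simp: trace_def permutes_card_image)
  also have "\<dots> = (\<Sum>A\<in>\<M>. \<Sum>(I, p)\<in>(SIGMA I:{I \<in> arcs n. card I = card A}. {p. p permutes {1..n} \<and> p ` I = A}). \<phi> p I)"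
    by (subst sum.Sigma) (use assms fI fP' in auto)
  also have "\<dots> = (\<Sum>A\<in>\<M>. \<Sum>I | I \<in> arcs n \<and> card I = card A. \<Sum>p | p permutes {1..n} \<and> p ` I = A. \<phi> p I)"
    by (intro sum.cong refl sum.Sigma[symmetric]) (use fI fP' in auto)
  finally show ?thesis .
qed

text \<open>A member \<open>A\<close> is the image of each of the \<open>n\<close> arcs of its size
  under \<open>fact n\<close> over \<open>n choose card A\<close> permutations; the weight cancels
  the binomial coefficient.\<close>

lemma sum_binomial_weight_trace:
  assumes "\<F> \<subseteq> Pow {1..n}" "\<And>A. A \<in> \<F> \<Longrightarrow> 1 \<le> card A \<and> card A < n"
  shows "(\<Sum>p | p permutes {1..n}. binomial_weight n (trace n p \<F>)) = real n * fact n * card \<F>"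
proof -
  have fin: "finite \<F>" using assms(1) finite_subset by blast
  have "(\<Sum>p | p permutes {1..n} \<and> p ` I = A. real (n choose card I)) = fact n"
    if "A \<in> \<F>" "I \<in> arcs n" "card I = card A" for A I
  proof -
    have "card {p. p permutes {1..n} \<and> p ` I = A} * (card {1..n} choose card A) = fact (card {1..n})"
      by (rule card_permutes_image) (use that assms(1) arcs_subset in auto)
    then have "real (card {p. p permutes {1..n} \<and> p ` I = A} * (n choose card A)) = fact n"
      by simp
    then show ?thesis using that by simp
  qed
  then have "(\<Sum>p | p permutes {1..n}. binomial_weight n (trace n p \<F>)) =
      (\<Sum>A\<in>\<F>. \<Sum>I | I \<in> arcs n \<and> card I = card A. fact n)"
    unfolding binomial_weight_def sum_trace_swap[OF fin] by (intro sum.cong refl) simp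
  also have "\<dots> = (\<Sum>A\<in>\<F>. real n * fact n)"
    using assms(2) by (intro sum.cong refl) (simp add: card_arcs_level)
  finally show ?thesis by simp
qed

text \<open>For a fixed subarc \<open>J\<close> of \<open>card L\<close> points the image is
  equidistributed among the subsets of \<open>M\<close> of that size, by \<open>card_flag\<close>. A
  union bound over the subarcs and \<open>double_choose_ge\<close> give the share
  \<open>2 / card M\<close>.\<close>

lemma card_subarc_image:
  assumes Q: "finite Q" "\<And>p. p \<in> Q \<Longrightarrow> inj p \<and> p ` I = M"
    and cl: "\<And>p q. p \<in> Q \<Longrightarrow> q permutes M \<Longrightarrow> q \<circ> p \<in> Q"
    and I: "I \<in> arcs n" "card I = card M" and L: "L \<subset> M" "2 \<le> card L" and M: "finite M"
  shows "card {p \<in> Q. \<exists>J\<in>arcs n. J \<subset> I \<and> p ` J = L} * card M \<le> 2 * card Q"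
proof -
  define j l where "j = card M" and "l = card L"
  have lj: "l < j" using L M by (simp add: j_def l_def psubset_card_mono)
  define Js where "Js = {J \<in> arcs n. card J = l \<and> J \<subseteq> I}"
  have finJ: "finite Js" using finite_arcs by (simp add: Js_def)
  define C where "C = (j choose l)"
  have C0: "0 < C" using lj by (simp add: C_def)
  have each: "card {p \<in> Q. p ` J = L} * C = card Q" if "J \<in> Js" for J
    unfolding C_def j_def l_def
  proof (rule card_flag[where I = I])
    show "J \<subseteq> I" "card J = card L" "L \<subseteq> M" using that L by (auto simp: Js_def l_def)
  qed (use Q M cl in auto)
  have "{p \<in> Q. \<exists>J\<in>arcs n. J \<subset> I \<and> p ` J = L} \<subseteq> (\<Union>J\<in>Js. {p \<in> Q. p ` J = L})"
  proof
    fix p assume "p \<in> {p \<in> Q. \<exists>J\<in>arcs n. J \<subset> I \<and> p ` J = L}"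
    then obtain J where J: "p \<in> Q" "J \<in> arcs n" "J \<subset> I" "p ` J = L" by auto
    then have "card J = l" using Q(2)[of p] by (auto simp: l_def card_image inj_on_subset)
    then show "p \<in> (\<Union>J\<in>Js. {p \<in> Q. p ` J = L})" using J by (auto simp: Js_def)
  qed
  then have "card {p \<in> Q. \<exists>J\<in>arcs n. J \<subset> I \<and> p ` J = L} \<le> card (\<Union>J\<in>Js. {p \<in> Q. p ` J = L})"
    using finJ Q(1) by (intro card_mono) auto
  also have "\<dots> \<le> (\<Sum>J\<in>Js. card {p \<in> Q. p ` J = L})" by (rule card_UN_le[OF finJ])
  finally have "card {p \<in> Q. \<exists>J\<in>arcs n. J \<subset> I \<and> p ` J = L} * C \<le> (\<Sum>J\<in>Js. card {p \<in> Q. p ` J = L}) * C"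
    by (rule mult_right_mono) simp
  also have "\<dots> = card Js * card Q" by (simp add: sum_distrib_right each)
  also have "card Js \<le> j - l + 1"
    unfolding Js_def using card_subarcs[OF I(1), of l] I(2) lj by (simp add: j_def)
  finally have le: "card {p \<in> Q. \<exists>J\<in>arcs n. J \<subset> I \<and> p ` J = L} * C \<le> (j - l + 1) * card Q"
    by (simp add: mult_right_mono)
  have "card {p \<in> Q. \<exists>J\<in>arcs n. J \<subset> I \<and> p ` J = L} * j * C \<le> (j - l + 1) * card Q * j"
    using mult_right_mono[OF le, of j] by (simp add: mult_ac)
  also have "\<dots> = (j - l + 1) * j * card Q" by simp
  also have "\<dots> \<le> 2 * C * card Q"
    unfolding C_def using double_choose_ge[of l j] L(2) lj by (intro mult_right_mono) (auto simp: l_def)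
  finally have "card {p \<in> Q. \<exists>J\<in>arcs n. J \<subset> I \<and> p ` J = L} * j * C \<le> 2 * card Q * C"
    by (simp add: mult_ac)
  then show ?thesis using C0 by (simp add: j_def)
qed

text \<open>This is \<open>card_subarc_image\<close> for the complements, which are arcs again:
  \<open>U\<close> above \<open>M\<close> becomes \<open>?S - U\<close> inside
  \<open>?S - M\<close>.\<close>

lemma card_superarc_image:
  assumes Q: "finite Q" "\<And>p. p \<in> Q \<Longrightarrow> p permutes {1..n} \<and> p ` I = M"
    and cl: "\<And>p q. p \<in> Q \<Longrightarrow> q permutes {1..n} - M \<Longrightarrow> q \<circ> p \<in> Q"
    and I: "I \<in> arcs n" "card I = card M" and U: "M \<subset> U" "U \<subseteq> {1..n}" "card U + 2 \<le> n"
  shows "card {p \<in> Q. \<exists>K\<in>arcs n. I \<subset> K \<and> p ` K = U} * (n - card M) \<le> 2 * card Q"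
proof -
  let ?S = "{1..n}"
  have "finite U" by (rule finite_subset[OF U(2)]) simp
  moreover have "finite M" by (rule finite_subset[OF psubset_imp_subset[OF U(1)] \<open>finite U\<close>])
  ultimately have finU: "finite U" "finite M" .
  have cSI: "card (?S - I) = n - card I"
    using card_Diff_subset[OF arcs_finite[OF I(1)] arcs_subset[OF I(1)]] by simp
  have "M \<subseteq> ?S" using U by auto
  then have cSM: "card (?S - M) = n - card M" using card_Diff_subset[OF finU(2)] by simp
  have cSU: "card (?S - U) = n - card U" using card_Diff_subset[OF finU(1) U(2)] by simp
  have "card {p \<in> Q. \<exists>J\<in>arcs n. J \<subset> ?S - I \<and> p ` J = ?S - U} * card (?S - M) \<le> 2 * card Q"
  proof (rule card_subarc_image[OF Q(1)])
    show "inj p \<and> p ` (?S - I) = ?S - M" if "p \<in> Q" for p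
      using Q(2)[OF that] by (auto simp: permutes_compl_image permutes_inj)
    show "q \<circ> p \<in> Q" if "p \<in> Q" "q permutes ?S - M" for p q using cl that by blast
    show "?S - I \<in> arcs n" using I arcs_compl by blast
    show "card (?S - I) = card (?S - M)"
      using I(2) cSI cSM by simp
    show "?S - U \<subset> ?S - M" using U by auto
    show "2 \<le> card (?S - U)" using U(3) cSU by simp
  qed auto
  moreover have "{p \<in> Q. \<exists>K\<in>arcs n. I \<subset> K \<and> p ` K = U} \<subseteq> {p \<in> Q. \<exists>J\<in>arcs n. J \<subset> ?S - I \<and> p ` J = ?S - U}"
  proof
    fix p assume "p \<in> {p \<in> Q. \<exists>K\<in>arcs n. I \<subset> K \<and> p ` K = U}"
    then obtain K where K: "p \<in> Q" "K \<in> arcs n" "I \<subset> K" "p ` K = U" by auto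
    then have "?S - K \<in> arcs n" "?S - K \<subset> ?S - I" "p ` (?S - K) = ?S - U"
      using Q(2)[OF K(1)] arcs_compl arcs_subset[OF K(2)] by (auto simp: permutes_compl_image)
    then show "p \<in> {p \<in> Q. \<exists>J\<in>arcs n. J \<subset> ?S - I \<and> p ` J = ?S - U}" using K(1) by blast
  qed
  then have "card {p \<in> Q. \<exists>K\<in>arcs n. I \<subset> K \<and> p ` K = U} \<le> card {p \<in> Q. \<exists>J\<in>arcs n. J \<subset> ?S - I \<and> p ` J = ?S - U}"
    using Q(1) by (intro card_mono) auto
  ultimately show ?thesis unfolding cSM by (meson mult_le_mono1 order_trans)
qed

text \<open>What a middle set at the arc \<open>I\<close> adds to four times the bound of its cycle: the weight of \<open>I\<close> if it
  has to be deleted to destroy a chain of three, the negative of the gain if it is isolated.\<close>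

definition excess :: "nat \<Rightarrow> real \<Rightarrow> nat set set \<Rightarrow> nat set \<Rightarrow> real" where
  "excess n \<delta> \<G> I =
     (if (\<exists>J\<in>\<G>. J \<subset> I) \<and> (\<exists>K\<in>\<G>. I \<subset> K) then 4 * real (n choose card I) else 0)
   - (if \<not> (\<exists>J\<in>\<G>. J \<subset> I) \<and> \<not> (\<exists>K\<in>\<G>. I \<subset> K) then 3 * \<delta> else 0)"

section \<open>Charging the middle sets\<close>

lemma butterfly_free_middleE:
  assumes "butterfly_free \<F>" "M \<in> middle \<F>"
  obtains L U where "L \<in> \<F>" "L \<subset> M" "\<And>A. A \<in> \<F> \<Longrightarrow> A \<subset> M \<Longrightarrow> A = L"
    "U \<in> \<F>" "M \<subset> U" "\<And>A. A \<in> \<F> \<Longrightarrow> M \<subset> A \<Longrightarrow> A = U"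
proof -
  obtain L U where LU: "L \<in> \<F>" "L \<subset> M" "U \<in> \<F>" "M \<subset> U" "M \<in> \<F>"
    using assms(2) by (auto simp: middle_def)
  have bf: "\<not> (distinct [W, X, Y, Z] \<and> W \<subseteq> Y \<and> W \<subseteq> Z \<and> X \<subseteq> Y \<and> X \<subseteq> Z)"
    if "W \<in> \<F>" "X \<in> \<F>" "Y \<in> \<F>" "Z \<in> \<F>" for W X Y Z
    using assms(1) that unfolding butterfly_free_def by blast
  \<comment> \<open>A second member below \<open>M\<close> would lie, like \<open>L\<close>, below
    both \<open>M\<close> and \<open>U\<close>.\<close>
  have "A = L" if "A \<in> \<F>" "A \<subset> M" for A
    using bf[of A L M U] that LU by auto
  moreover have "A = U" if "A \<in> \<F>" "M \<subset> A" for A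
    using bf[of L M A U] that LU by auto
  ultimately show ?thesis using LU that by blast
qed

text \<open>Among the permutations that send \<open>I\<close> to \<open>M\<close>, both neighbours
  of \<open>M\<close> are arcs for a share of at most \<open>4 / (j * (n - j))\<close>, and neither
  is for at least \<open>1 - 2 / j - 2 / (n - j)\<close>. Multiplied by \<open>j * (n - j)\<close>,
  the cost \<open>4 * C\<close> on the first share against the gain \<open>3 * \<delta>\<close> on
  the second is the inequality \<open>weight\<close>.\<close>

lemma sum_excess_neg:
  assumes \<F>: "\<F> \<subseteq> Pow {1..n}" "butterfly_free \<F>"
    and sizes: "\<And>A. A \<in> \<F> \<Longrightarrow> 2 \<le> card A \<and> card A + 2 \<le> n"
    and M: "M \<in> middle \<F>" and I: "I \<in> arcs n" "card I = card M" and \<delta>: "0 \<le> \<delta>"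
    and weight: "16 * real (n choose card M) < 3 * \<delta> * (real (card M) * real (n - card M) - 2 * real n)"
  shows "(\<Sum>p | p permutes {1..n} \<and> p ` I = M. excess n \<delta> (trace n p \<F>) I) < 0"
proof -
  let ?S = "{1..n}"
  obtain L U where L: "L \<in> \<F>" "L \<subset> M" "\<And>A. A \<in> \<F> \<Longrightarrow> A \<subset> M \<Longrightarrow> A = L"
    and U: "U \<in> \<F>" "M \<subset> U" "\<And>A. A \<in> \<F> \<Longrightarrow> M \<subset> A \<Longrightarrow> A = U"
    using butterfly_free_middleE[OF \<F>(2) M] by blast
  have MF: "M \<in> \<F>" using M by (simp add: middle_def)
  then have MS: "M \<subseteq> ?S" using \<F>(1) by blast
  have US: "U \<subseteq> ?S" using \<F>(1) U(1) by blast
  have finM: "finite M" by (rule finite_subset[OF MS]) simp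
  define Q where "Q = {p. p permutes ?S \<and> p ` I = M}"
  define QL where "QL = {p \<in> Q. \<exists>J\<in>arcs n. J \<subset> I \<and> p ` J = L}"
  define QU where "QU = {p \<in> Q. \<exists>K\<in>arcs n. I \<subset> K \<and> p ` K = U}"
  have finQ: "finite Q" unfolding Q_def
    by (rule finite_subset[of _ "{p. p permutes ?S}"]) (auto simp: finite_permutations)
  \<comment> \<open>As \<open>L\<close> is the only member below \<open>M\<close>, an arc of the
    trace strictly inside \<open>I\<close> must be sent to \<open>L\<close>.\<close>
  have inQL: "(\<exists>J\<in>trace n p \<F>. J \<subset> I) \<longleftrightarrow> p \<in> QL" if "p \<in> Q" for p
  proof -
    have p: "p permutes ?S" "p ` I = M" using that by (auto simp: Q_def)
    have "p ` J = L" if "p ` J \<in> \<F>" "J \<subset> I" for J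
      using L(3)[OF that(1)] permutes_image_psubset[OF p(1), of J I] p(2) that(2) by simp
    then show ?thesis using that L(1) by (auto simp: QL_def trace_def)
  qed
  have inQU: "(\<exists>K\<in>trace n p \<F>. I \<subset> K) \<longleftrightarrow> p \<in> QU" if "p \<in> Q" for p
  proof -
    have p: "p permutes ?S" "p ` I = M" using that by (auto simp: Q_def)
    have "p ` K = U" if "p ` K \<in> \<F>" "I \<subset> K" for K
      using U(3)[OF that(1)] permutes_image_psubset[OF p(1), of I K] p(2) that(2) by simp
    then show ?thesis using that U(1) by (auto simp: QU_def trace_def)
  qed
  define j where "j = card M"
  define C where "C = real (n choose j)"
  have j: "0 < j" "j < n" using sizes[OF MF] by (auto simp: j_def)
  have excess: "excess n \<delta> (trace n p \<F>) I =
      (if p \<in> QL \<inter> QU then 4 * C else 0) - (if p \<in> Q - QL - QU then 3 * \<delta> else 0)" if "p \<in> Q" for p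
    unfolding excess_def inQL[OF that] inQU[OF that] using that I(2) by (simp add: C_def j_def)
  have "(\<Sum>p\<in>Q. excess n \<delta> (trace n p \<F>) I) =
      (\<Sum>p\<in>Q. if p \<in> QL \<inter> QU then 4 * C else 0) - (\<Sum>p\<in>Q. if p \<in> Q - QL - QU then 3 * \<delta> else 0)"
    unfolding sum_subtractf[symmetric] using excess by (intro sum.cong) auto
  also have "(\<Sum>p\<in>Q. if p \<in> QL \<inter> QU then 4 * C else 0) = 4 * C * card (QL \<inter> QU)"
  proof -
    have "Q \<inter> (QL \<inter> QU) = QL \<inter> QU" by (auto simp: QL_def)
    then show ?thesis using sum.inter_restrict[OF finQ, of "\<lambda>_. 4 * C" "QL \<inter> QU"] by (simp add: mult.commute)
  qed
  also have "(\<Sum>p\<in>Q. if p \<in> Q - QL - QU then 3 * \<delta> else 0) = 3 * \<delta> * card (Q - QL - QU)"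
  proof -
    have "Q \<inter> (Q - QL - QU) = Q - QL - QU" by auto
    then show ?thesis using sum.inter_restrict[OF finQ, of "\<lambda>_. 3 * \<delta>" "Q - QL - QU"] by (simp add: mult.commute)
  qed
  finally have sum: "(\<Sum>p\<in>Q. excess n \<delta> (trace n p \<F>) I) =
      4 * C * card (QL \<inter> QU) - 3 * \<delta> * card (Q - QL - QU)" .

  have fixM: "q ` A = A" if "q permutes ?S - M" "A \<subseteq> M" for q A
    using that permutes_not_in[OF that(1)] by (auto simp: image_def subset_iff)
  have qL: "card QL * j \<le> 2 * card Q"
    unfolding QL_def j_def
  proof (rule card_subarc_image[OF finQ _ _ I L(2) _ finM])
    show "inj p \<and> p ` I = M" if "p \<in> Q" for p using that by (auto simp: Q_def permutes_inj)
    show "q \<circ> p \<in> Q" if pq: "p \<in> Q" "q permutes M" for p q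
    proof -
      have "(q \<circ> p) ` I = q ` (p ` I)" by (rule image_comp[symmetric])
      also have "\<dots> = M" using pq permutes_image[OF pq(2)] by (simp add: Q_def)
      finally show ?thesis
        using pq(1) permutes_subset[OF pq(2) MS] by (simp add: Q_def permutes_compose)
    qed
    show "2 \<le> card L" using sizes L(1) by blast
  qed
  have compQ: "q \<circ> p \<in> Q" if pq: "p \<in> Q" "q permutes ?S - M" for p q
  proof -
    have "(q \<circ> p) ` I = q ` (p ` I)" by (rule image_comp[symmetric])
    also have "\<dots> = M" using pq(1) fixM[OF pq(2), of M] by (simp add: Q_def)
    finally show ?thesis
      using pq(1) permutes_subset[OF pq(2), of ?S] by (simp add: Q_def permutes_compose Diff_subset)
  qed
  have qU: "card QU * (n - j) \<le> 2 * card Q"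
    unfolding QU_def j_def
  proof (rule card_superarc_image[OF finQ _ compQ I U(2) US])
    show "p permutes ?S \<and> p ` I = M" if "p \<in> Q" for p using that by (simp add: Q_def)
    show "card U + 2 \<le> n" using sizes U(1) by blast
  qed
  \<comment> \<open>The count for \<open>U\<close> is repeated inside \<open>QL\<close>:
    permutations of the complement of \<open>M\<close> fix \<open>L\<close> pointwise, so
    \<open>QL\<close> is closed under them.\<close>
  have qLU: "card (QL \<inter> QU) * (n - j) \<le> 2 * card QL"
  proof -
    have "QL \<inter> QU = {p \<in> QL. \<exists>K\<in>arcs n. I \<subset> K \<and> p ` K = U}" by (auto simp: QL_def QU_def)
    moreover have "card {p \<in> QL. \<exists>K\<in>arcs n. I \<subset> K \<and> p ` K = U} * (n - card M) \<le> 2 * card QL"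
    proof (rule card_superarc_image[OF _ _ _ I U(2) US])
      show "finite QL" using finQ by (simp add: QL_def)
      show "p permutes ?S \<and> p ` I = M" if "p \<in> QL" for p using that by (simp add: QL_def Q_def)
      show "card U + 2 \<le> n" using sizes U(1) by blast
      show "q \<circ> p \<in> QL" if pq: "p \<in> QL" "q permutes ?S - M" for p q
      proof -
        obtain J where J: "p \<in> Q" "J \<in> arcs n" "J \<subset> I" "p ` J = L" using pq(1) by (auto simp: QL_def)
        have "(q \<circ> p) ` J = q ` (p ` J)" by (rule image_comp[symmetric])
        also have "\<dots> = L" using J(4) fixM[OF pq(2), of L] L(2) by auto
        finally show ?thesis using J compQ[OF J(1) pq(2)] unfolding QL_def by blast
      qed
    qed
    ultimately show ?thesis by (simp add: j_def)
  qed
  have cover: "card Q \<le> card (Q - QL - QU) + card QL + card QU"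
  proof -
    have "Q = (Q - QL - QU) \<union> QL \<union> QU" by (auto simp: QL_def QU_def)
    then have "card Q = card ((Q - QL - QU) \<union> QL \<union> QU)" by (rule arg_cong)
    then show ?thesis
      using card_Un_le[of "(Q - QL - QU) \<union> QL" QU] card_Un_le[of "Q - QL - QU" QL] by linarith
  qed
  have Q0: "0 < card Q"
  proof -
    obtain q where "q permutes ?S" "q ` I = M"
      by (rule ex_permutes_image[of ?S I M]) (use MS I arcs_subset in auto)
    then show ?thesis using finQ by (auto simp: Q_def card_gt_0_iff)
  qed
  define a ql qu b s k where "a = real (card Q)" and "ql = real (card QL)" and "qu = real (card QU)"
    and "b = real (card (QL \<inter> QU))" and "s = real (card (Q - QL - QU))" and "k = real (n - j)"
  have r: "ql * j \<le> 2 * a" "qu * k \<le> 2 * a" "b * k \<le> 2 * ql" "a \<le> s + ql + qu" "0 < a"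
    using of_nat_mono[OF qL] of_nat_mono[OF qU] of_nat_mono[OF qLU] of_nat_mono[OF cover] Q0
    by (simp_all add: a_def ql_def qu_def b_def s_def k_def)
  have k: "0 < k" "real n = real j + k" using j by (auto simp: k_def)
  have "b * (j * k) \<le> 4 * a"
    using mult_right_mono[OF r(3), of "real j"] r(1) by (simp add: mult_ac)
  then have 1: "4 * C * b * (j * k) \<le> 16 * C * a"
    using mult_left_mono[of "b * (j * k)" "4 * a" "4 * C"] by (simp add: C_def mult_ac)
  have "a * (j * k) \<le> s * (j * k) + ql * j * k + qu * k * j"
    using mult_right_mono[OF r(4), of "j * k"] k by (simp add: algebra_simps)
  also have "\<dots> \<le> s * (j * k) + 2 * a * k + 2 * a * j"
    using mult_right_mono[OF r(1) less_imp_le[OF k(1)]] mult_right_mono[OF r(2), of "real j"] by linarith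
  finally have "a * (j * k - 2 * n) \<le> s * (j * k)" using k by (simp add: algebra_simps)
  then have 2: "3 * \<delta> * (a * (j * k - 2 * n)) \<le> 3 * \<delta> * (s * (j * k))"
    using \<delta> by (intro mult_left_mono) auto
  have "16 * C * a < 3 * \<delta> * (j * k - 2 * n) * a"
    using weight r(5) by (intro mult_strict_right_mono) (simp_all add: C_def j_def k_def)
  then have "(4 * C * b) * (j * k) < (3 * \<delta> * s) * (j * k)" using 1 2 by (simp add: mult_ac)
  then have "4 * C * b < 3 * \<delta> * s" using j k by (simp add: mult_less_cancel_right)
  then show ?thesis using sum by (simp add: Q_def b_def s_def)
qed

text \<open>An arc in the middle of the trace is sent to a middle set of \<open>\<F>\<close>, so
  deleting the arcs in \<open>bad\<close> leaves no chain of three and \<open>cyc\<close> applies.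
  The deleted weight and the gain from isolated arcs together form the excess.\<close>

lemma binomial_weight_trace_le:
  fixes \<delta> \<beta> :: real
  assumes \<F>: "\<F> \<subseteq> Pow {1..n}" "intersecting \<F>" and p: "p permutes {1..n}" and \<delta>: "0 \<le> \<delta>"
    and cyc: "\<And>\<G>. \<G> \<subseteq> arcs n \<Longrightarrow> intersecting \<G> \<Longrightarrow> middle \<G> = {} \<Longrightarrow>
      4 * binomial_weight n \<G> + 3 * \<delta> * card (isolated \<G>) \<le> 4 * \<beta>"
  shows "4 * binomial_weight n (trace n p \<F>) \<le> 4 * \<beta> + (\<Sum>I\<in>trace n p (middle \<F>). excess n \<delta> (trace n p \<F>) I)"
proof -
  define \<G> where "\<G> = trace n p \<F>"
  define \<M> where "\<M> = trace n p (middle \<F>)"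
  define bad where "bad = {I \<in> \<M>. (\<exists>J\<in>\<G>. J \<subset> I) \<and> (\<exists>K\<in>\<G>. I \<subset> K)}"
  define iso where "iso = {I \<in> \<M>. \<not> (\<exists>J\<in>\<G>. J \<subset> I) \<and> \<not> (\<exists>K\<in>\<G>. I \<subset> K)}"
  have fin: "finite \<G>" "finite \<M>" by (simp_all add: \<G>_def \<M>_def finite_trace)
  have sub: "\<M> \<subseteq> \<G>" by (auto simp: \<M>_def \<G>_def trace_def middle_def)
  have "middle (\<G> - bad) = {}"
  proof -
    have "M \<in> bad" if mM: "M \<in> middle (\<G> - bad)" for M
    proof -
      obtain L U where LU: "L \<in> \<G>" "U \<in> \<G>" "L \<subset> M" "M \<subset> U" "M \<in> \<G>" using mM unfolding middle_def by blast
      then have "p ` L \<subset> p ` M" "p ` M \<subset> p ` U" using permutes_image_psubset[OF p] by auto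
      moreover have "p ` L \<in> \<F>" "p ` U \<in> \<F>" "p ` M \<in> \<F>" "M \<in> arcs n"
        using LU by (simp_all add: \<G>_def trace_def)
      ultimately have "p ` M \<in> middle \<F>"
        unfolding middle_def by (intro CollectI conjI bexI[of _ "p ` L"] bexI[of _ "p ` U"])
      then have "M \<in> \<M>" using \<open>M \<in> arcs n\<close> by (simp add: \<M>_def trace_def)
      then show ?thesis
        unfolding bad_def using LU by (intro CollectI conjI bexI[of _ L] bexI[of _ U])
    qed
    then show ?thesis by (auto simp: middle_def)
  qed
  moreover have "intersecting (\<G> - bad)"
    using intersecting_trace[OF p \<F>(2)] by (auto simp: intersecting_def \<G>_def)
  moreover have "\<G> - bad \<subseteq> arcs n" using trace_subset by (auto simp: \<G>_def)
  ultimately have "4 * binomial_weight n (\<G> - bad) + 3 * \<delta> * card (isolated (\<G> - bad)) \<le> 4 * \<beta>" by (intro cyc)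
  \<comment> \<open>Deletion keeps isolated arcs isolated; it may only create further ones.\<close>
  moreover have "card iso \<le> card (isolated (\<G> - bad))"
    using fin sub by (intro card_mono) (auto simp: iso_def isolated_def bad_def)
  then have "3 * \<delta> * card iso \<le> 3 * \<delta> * card (isolated (\<G> - bad))"
    using \<delta> by (intro mult_left_mono) auto
  moreover have "binomial_weight n \<G> = binomial_weight n (\<G> - bad) + binomial_weight n bad"
    unfolding binomial_weight_def using fin sub by (intro sum.subset_diff) (auto simp: bad_def)
  moreover have "(\<Sum>I\<in>\<M>. excess n \<delta> \<G> I) = 4 * binomial_weight n bad - 3 * \<delta> * card iso"
  proof -
    have "(\<Sum>I\<in>\<M>. excess n \<delta> \<G> I) = (\<Sum>I\<in>bad. 4 * real (n choose card I)) - (\<Sum>I\<in>iso. 3 * \<delta>)"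
      unfolding excess_def sum_subtractf bad_def iso_def sum.inter_filter[OF fin(2)] ..
    then show ?thesis by (simp add: binomial_weight_def sum_distrib_left)
  qed
  ultimately show ?thesis unfolding \<G>_def \<M>_def by linarith
qed

lemma sum_neg_nonempty:
  fixes f :: "'a \<Rightarrow> real"
  assumes "finite A" "A \<noteq> {}" "\<And>x. x \<in> A \<Longrightarrow> f x < 0"
  shows "sum f A < 0"
  using sum_strict_mono[of A f "\<lambda>_. 0"] assms by simp

text \<open>Every middle set contributes a negative total excess, so \<open>E\<close> is at most 0
  and vanishes only if there is no middle set. Then no cycle exceeds \<open>\<beta>\<close>, and if
  the average is \<open>\<beta>\<close> every cycle attains it.\<close>

lemma cycle_averaging:
  fixes \<delta> \<beta> :: real
  assumes \<F>: "\<F> \<subseteq> Pow {1..n}" "intersecting \<F>" "butterfly_free \<F>"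
    and sizes: "\<And>A. A \<in> \<F> \<Longrightarrow> 2 \<le> card A \<and> card A + 2 \<le> n" and \<delta>: "0 \<le> \<delta>"
    and cyc: "\<And>\<G>. \<G> \<subseteq> arcs n \<Longrightarrow> intersecting \<G> \<Longrightarrow> middle \<G> = {} \<Longrightarrow>
      4 * binomial_weight n \<G> + 3 * \<delta> * card (isolated \<G>) \<le> 4 * \<beta>"
    and weight: "\<And>j. 3 \<le> j \<Longrightarrow> j + 3 \<le> n \<Longrightarrow>
      16 * real (n choose j) < 3 * \<delta> * (real j * real (n - j) - 2 * real n)"
  shows "real n * card \<F> \<le> \<beta>"
    and "real n * card \<F> = \<beta> \<Longrightarrow> middle \<F> = {}"
    and "real n * card \<F> = \<beta> \<Longrightarrow> p permutes {1..n} \<Longrightarrow> binomial_weight n (trace n p \<F>) = \<beta>"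
proof -
  let ?P = "{p. p permutes {1..n}}"
  define E where "E = (\<Sum>p\<in>?P. \<Sum>I\<in>trace n p (middle \<F>). excess n \<delta> (trace n p \<F>) I)"
  have finF: "finite \<F>" by (rule finite_subset[OF \<F>(1)]) simp
  then have finM: "finite (middle \<F>)" by (simp add: middle_def)
  have finP: "finite ?P" by (simp add: finite_permutations)
  have cP: "card ?P = fact n" by (simp add: card_permutations)
  have total: "(\<Sum>p\<in>?P. binomial_weight n (trace n p \<F>)) = real n * fact n * card \<F>"
    by (rule sum_binomial_weight_trace[OF \<F>(1)]) (use sizes in fastforce)
  have "(\<Sum>p\<in>?P. 4 * binomial_weight n (trace n p \<F>)) \<le>
      (\<Sum>p\<in>?P. 4 * \<beta> + (\<Sum>I\<in>trace n p (middle \<F>). excess n \<delta> (trace n p \<F>) I))"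
    by (intro sum_mono binomial_weight_trace_le[OF \<F>(1,2) _ \<delta> cyc]) auto
  then have main: "4 * (real n * fact n * card \<F>) \<le> 4 * (fact n * \<beta>) + E"
    by (simp add: sum.distrib total cP E_def sum_distrib_left[symmetric])
  have neg: "(\<Sum>I | I \<in> arcs n \<and> card I = card M. \<Sum>p | p permutes {1..n} \<and> p ` I = M.
      excess n \<delta> (trace n p \<F>) I) < 0" if M: "M \<in> middle \<F>" for M
  proof (rule sum_neg_nonempty)
    obtain L U where LU: "L \<in> \<F>" "U \<in> \<F>" "L \<subset> M" "M \<subset> U" "M \<in> \<F>" using M by (auto simp: middle_def)
    have "finite U" "finite M" using LU \<F>(1) by (meson PowD finite_atLeastAtMost finite_subset subsetD)+
    then have "card L < card M" "card M < card U" using LU psubset_card_mono by blast+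
    \<comment> \<open>\<open>M\<close> lies strictly between members of size at least 2 and at most
      \<open>n - 2\<close>.\<close>
    then have j: "3 \<le> card M" "card M + 3 \<le> n" using sizes[OF LU(1)] sizes[OF LU(2)] by linarith+
    show "{I. I \<in> arcs n \<and> card I = card M} \<noteq> {}"
    proof -
      have "card {I. I \<in> arcs n \<and> card I = card M} = n" using j by (intro card_arcs_level) auto
      then show ?thesis using j by (metis card.empty add_is_0 le_zero_eq zero_neq_numeral)
    qed
    show "(\<Sum>p | p permutes {1..n} \<and> p ` I = M. excess n \<delta> (trace n p \<F>) I) < 0"
      if "I \<in> {I. I \<in> arcs n \<and> card I = card M}" for I
      by (rule sum_excess_neg[OF \<F>(1,3) sizes M _ _ \<delta> weight]) (use that j in auto)
    show "finite {I. I \<in> arcs n \<and> card I = card M}" using finite_arcs by simp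
  qed
  have E: "E = (\<Sum>M\<in>middle \<F>. \<Sum>I | I \<in> arcs n \<and> card I = card M. \<Sum>p | p permutes {1..n} \<and> p ` I = M.
      excess n \<delta> (trace n p \<F>) I)"
    unfolding E_def by (rule sum_trace_swap[OF finM])
  have E0: "E \<le> 0" unfolding E by (rule sum_nonpos) (rule less_imp_le[OF neg])
  have fct: "(0::real) < fact n" by simp
  have comm: "real n * fact n * card \<F> = fact n * (real n * card \<F>)" by simp
  have "fact n * (real n * card \<F>) \<le> fact n * \<beta>" using main E0 unfolding comm by linarith
  then show "real n * card \<F> \<le> \<beta>" by (rule mult_left_le_imp_le[OF _ fct])
  assume eq: "real n * card \<F> = \<beta>"
  then have "E = 0" using main E0 unfolding comm by simp
  show mid: "middle \<F> = {}"
  proof (rule ccontr)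
    assume "middle \<F> \<noteq> {}"
    then have "E < 0" unfolding E by (rule sum_neg_nonempty[OF finM _ neg])
    then show False using \<open>E = 0\<close> by simp
  qed
  assume p: "p permutes {1..n}"
  have le: "binomial_weight n (trace n q \<F>) \<le> \<beta>" if "q \<in> ?P" for q
  proof -
    have "trace n q (middle \<F>) = {}" using mid by (simp add: trace_def)
    moreover have "4 * binomial_weight n (trace n q \<F>) \<le> 4 * \<beta> + (\<Sum>I\<in>trace n q (middle \<F>). excess n \<delta> (trace n q \<F>) I)"
      by (rule binomial_weight_trace_le[OF \<F>(1,2) _ \<delta> cyc]) (use that in auto)
    ultimately show ?thesis by simp
  qed
  have "(\<Sum>q\<in>?P. \<beta> - binomial_weight n (trace n q \<F>)) = 0"
    using total eq by (simp add: sum_subtractf cP mult_ac)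
  then have "\<forall>q\<in>?P. \<beta> - binomial_weight n (trace n q \<F>) = 0"
    using le finP by (subst (asm) sum_nonneg_eq_0_iff) auto
  then show "binomial_weight n (trace n p \<F>) = \<beta>" using p by simp
qed

section \<open>Tight families in the cycle method\<close>

text \<open>The equality case of Katona's argument on one cycle. Members other than the arc at 1
  meet it, hence come from \<open>k - 1\<close> pairs of disjoint arcs, and each pair must supply
  exactly one. Starting from the missing arc at 0, the choice in each pair is forced, so the members
  are the arcs starting at 1 to \<open>k\<close>.\<close>

lemma consecutive_arcs:
  assumes k: "1 \<le> k" "2 * k < n" and \<G>: "\<G> \<subseteq> {I \<in> arcs n. card I = k}" "intersecting \<G>" "card \<G> = k"
    and start: "arc n 0 k \<notin> \<G>" "arc n 1 k \<in> \<G>" and a: "a < k"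
  shows "arc n (1 + a) k \<in> \<G>"
proof -
  \<comment> \<open>The partner starts at \<open>1 + j - k\<close>, raised by \<open>n\<close> to
    avoid truncation: it ends just before \<open>arc n (1 + j) k\<close> begins.\<close>
  define X where "X j = \<G> \<inter> {arc n (1 + j) k, arc n (n + 1 + j - k) k}" for j
  have fin: "finite \<G>" by (rule finite_subset[OF \<G>(1)]) (simp add: finite_arcs)
  have excl: "\<not> (I \<in> \<G> \<and> J \<in> \<G>)" if "I \<inter> J = {}" for I J
    using \<G>(2) that by (auto simp: intersecting_def)
  have one: "card (X j) \<le> 1" if "j < k" for j
  proof -
    have "arc n (1 + j) k \<inter> arc n (1 + j + (n - k)) k = {}" using k by (intro arc_disjoint) auto
    moreover have "1 + j + (n - k) = n + 1 + j - k" using k by simp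
    ultimately have "X j \<subseteq> {arc n (1 + j) k} \<or> X j \<subseteq> {arc n (n + 1 + j - k) k}"
      using excl unfolding X_def by auto
    then show ?thesis using card_mono[of "{_}" "X j"] by fastforce
  qed
  have cover: "\<G> \<subseteq> insert (arc n 1 k) (\<Union>j\<in>{1..<k}. X j)"
  proof
    fix I assume I: "I \<in> \<G>"
    then obtain i where i: "i < n" "I = arc n i k" using \<G>(1) by (auto elim!: arcsE)
    have "i \<noteq> 0" using I i start(1) by (intro notI) simp
    have "i \<le> k \<or> n + 1 < i + k"
    proof (rule ccontr)
      assume "\<not> ?thesis"
      then have "arc n 1 k \<inter> arc n (1 + (i - 1)) k = {}" by (intro arc_disjoint) auto
      then show False using excl[of "arc n 1 k" I] I i \<open>i \<noteq> 0\<close> start(2) by simp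
    qed
    then consider "i = 1" | "1 \<le> i - 1" "i - 1 < k" "i = 1 + (i - 1)"
      | "1 \<le> i + k - (n + 1)" "i + k - (n + 1) < k" "i = n + 1 + (i + k - (n + 1)) - k"
      using \<open>i \<noteq> 0\<close> i(1) by linarith
    then show "I \<in> insert (arc n 1 k) (\<Union>j\<in>{1..<k}. X j)"
    proof cases
      case 1
      then show ?thesis using i by simp
    next
      case 2
      then have "I \<in> X (i - 1)" unfolding X_def using I i by simp
      then show ?thesis using 2 by auto
    next
      case 3
      then have "I \<in> X (i + k - (n + 1))" unfolding X_def using I i by simp
      then show ?thesis using 3 by auto
    qed
  qed
  \<comment> \<open>An empty pair would leave at most \<open>1 + (k - 2)\<close> members.\<close>
  have ne: "X j \<noteq> {}" if j: "1 \<le> j" "j < k" for j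
  proof
    assume e: "X j = {}"
    have "k \<le> card (insert (arc n 1 k) (\<Union>j\<in>{1..<k}. X j))"
      using card_mono[OF _ cover] fin \<G>(3) by (simp add: X_def)
    also have "\<dots> \<le> Suc (card (\<Union>j\<in>{1..<k}. X j))" by (simp add: X_def card_insert_if)
    also have "card (\<Union>j\<in>{1..<k}. X j) \<le> (\<Sum>j\<in>{1..<k}. card (X j))" by (rule card_UN_le) simp
    also have "\<dots> = (\<Sum>j\<in>{1..<k} - {j}. card (X j))"
      using j e by (subst sum.remove[of _ j]) auto
    also have "\<dots> \<le> (\<Sum>j\<in>{1..<k} - {j}. 1)" using one by (intro sum_mono) auto
    also have "\<dots> = k - 1 - 1" using j by simp
    finally show False using j by simp
  qed
  \<comment> \<open>The induction runs backwards from \<open>j = k - 1\<close>, whose partner is the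
    missing arc at 0. After that the partner in pair \<open>j\<close> is disjoint from the member at
    \<open>1 + Suc j\<close>, by \<open>2 * k < n\<close>.\<close>
  have "arc n (1 + (k - 1 - b)) k \<in> \<G>" if "b < k" for b
    using that
  proof (induction b)
    case 0
    show ?case
    proof (cases "k = 1")
      case False
      have "n + 1 + (k - 1) - k = n" using k by simp
      moreover have "arc n n k = arc n 0 k" using arc_mod[of n n k] by simp
      ultimately show ?thesis using ne[of "k - 1"] False k(1) start(1) by (auto simp: X_def)
    qed (use start in simp)
  next
    case (Suc b)
    define j where "j = k - 1 - Suc b"
    have P: "arc n (1 + Suc j) k \<in> \<G>" using Suc by (simp add: j_def Suc_diff_Suc)
    have "arc n (1 + j) k \<in> \<G>"
    proof (cases "j = 0")
      case True
      then show ?thesis using start(2) by simp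
    next
      case False
      have "arc n (1 + Suc j) k \<inter> arc n (1 + Suc j + (n - k - 1)) k = {}" using k by (intro arc_disjoint) auto
      moreover have "1 + Suc j + (n - k - 1) = n + 1 + j - k" using k by simp
      ultimately have "arc n (n + 1 + j - k) k \<notin> \<G>" using excl P by metis
      moreover have "j < k" using k by (simp add: j_def)
      ultimately show ?thesis using ne[of j] False by (auto simp: X_def)
    qed
    then show ?case unfolding j_def .
  qed
  from this[of "k - 1 - a"] show ?thesis using a by simp
qed

text \<open>Allows a cycle to be prescribed as a list: arcs that do not wrap around become segments
  of the list.\<close>

lemma permutation_of_list:
  assumes "distinct xs" "set xs = {1..n}"
  obtains p where "p permutes {1..n}" "\<And>i l. i + l \<le> n \<Longrightarrow> p ` arc n i l = set (take l (drop i xs))"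
proof -
  have len: "length xs = n" using distinct_card[OF assms(1)] assms(2) by simp
  define p where "p = (\<lambda>v. if v \<in> {1..n} then xs ! (v - 1) else v)"
  have "inj_on p {1..n}"
    using assms(1) len by (auto simp: inj_on_def p_def nth_eq_iff_index_eq)
  moreover have "p ` {1..n} \<subseteq> {1..n}"
    using assms(2) len nth_mem[of _ xs] by (fastforce simp: p_def)
  ultimately have "bij_betw p {1..n} {1..n}"
    by (simp add: bij_betw_def endo_inj_surj)
  then have perm: "p permutes {1..n}" by (rule bij_imp_permutes) (auto simp: p_def)
  have "p ` arc n i l = set (take l (drop i xs))" if "i + l \<le> n" for i l
  proof -
    have "p ` arc n i l = (\<lambda>t. xs ! (i + t)) ` {..<l}"
      unfolding arc_def image_image by (rule image_cong) (use that in \<open>auto simp: p_def\<close>)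
    also have "\<dots> = set (map (\<lambda>t. xs ! (i + t)) [0..<l])" by (simp add: lessThan_atLeast0)
    also have "map (\<lambda>t. xs ! (i + t)) [0..<l] = take l (drop i xs)"
      by (rule nth_equalityI) (use that len in auto)
    finally show ?thesis .
  qed
  then show ?thesis using perm that by blast
qed

text \<open>If no exchange for an element of \<open>B\<close> led out of \<open>\<D>\<close>,
  replacing the elements of \<open>A - B\<close> one by one by those of \<open>B - A\<close> would
  lead from \<open>A\<close> to \<open>B\<close> within \<open>\<D>\<close>.\<close>

lemma exchange_boundary:
  assumes "A \<in> \<D>" "B \<notin> \<D>" "finite A" "finite B" "card A = card B"
  obtains A' x y where "A' \<in> \<D>" "x \<in> A'" "y \<notin> A'" "y \<in> B" "insert y (A' - {x}) \<notin> \<D>"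
proof (rule ccontr)
  assume "\<not> thesis"
  then have closed: "\<And>A' x y. A' \<in> \<D> \<Longrightarrow> x \<in> A' \<Longrightarrow> y \<notin> A' \<Longrightarrow> y \<in> B \<Longrightarrow> insert y (A' - {x}) \<in> \<D>"
    using that by blast
  have "B \<in> \<D>" if "A' \<in> \<D>" "finite A'" "card A' = card B" for A'
    using that
  proof (induction "card (A' - B)" arbitrary: A')
    case 0
    then have "A' \<subseteq> B" by simp
    then show ?case using 0 assms(4) card_subset_eq by metis
  next
    case (Suc d)
    then obtain x where x: "x \<in> A'" "x \<notin> B" by (metis DiffE card.empty equals0I nat.distinct(1))
    then have "\<not> B \<subseteq> A'" using Suc.prems card_subset_eq[of A' B] by auto
    then obtain y where y: "y \<in> B" "y \<notin> A'" by auto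
    have "insert y (A' - {x}) - B = (A' - B) - {x}" using y by auto
    then have "card (insert y (A' - {x}) - B) = d" using x Suc by (simp add: card_Diff_singleton)
    moreover have "card (insert y (A' - {x})) = card B"
      using Suc.prems(2,3) x(1) y(2) card_Suc_Diff1[of A' x] by simp
    ultimately show ?case using Suc closed[OF Suc.prems(1) x(1) y(2,1)] by (metis finite_Diff finite_insert)
  qed
  then show False using assms by blast
qed

text \<open>Take \<open>A\<close> in \<open>\<D>\<close> such that replacing \<open>x\<close> in \<open>A\<close> by \<open>y\<close> leads out of \<open>\<D>\<close>. On a cycle that lists \<open>y\<close>,
  \<open>A - B\<close>, the rest of \<open>A\<close> with \<open>x\<close> last, \<open>B - A\<close>, the run of members starts at \<open>A\<close> and reaches \<open>B\<close>; so
  every \<open>B\<close> through \<open>x\<close> that avoids \<open>y\<close> belongs to \<open>\<D>\<close>.\<close>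

lemma katona_tight_star:
  assumes k: "1 \<le> k" "2 * k < n" and \<D>: "\<D> \<subseteq> {B. B \<subseteq> {1..n} \<and> card B = k}" "intersecting \<D>"
    and tight: "\<And>p. p permutes {1..n} \<Longrightarrow> card (trace n p \<D>) = k"
  obtains x where "x \<in> {1..n}" "\<D> = {B. B \<subseteq> {1..n} \<and> card B = k \<and> x \<in> B}"
proof -
  let ?S = "{1..n}"
  have "trace n id \<D> \<noteq> {}" using tight[of id] k(1) permutes_id by (metis card.empty not_one_le_zero)
  then obtain A0 where A0: "A0 \<in> \<D>" by (auto simp: trace_def)
  then have A0': "A0 \<subseteq> ?S" "card A0 = k" "finite A0" using \<D>(1) by (auto intro: finite_subset)
  then have "k \<le> card (?S - A0)" using k by (simp add: card_Diff_subset)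
  then obtain B0 where B0: "B0 \<subseteq> ?S - A0" "card B0 = k" "finite B0" by (rule obtain_subset_with_card_n)
  have "B0 \<notin> \<D>" using \<D>(2) A0 B0(1) by (auto simp: intersecting_def)
  then obtain A x y where A: "A \<in> \<D>" "x \<in> A" "y \<notin> A" "y \<in> B0" "insert y (A - {x}) \<notin> \<D>"
    using exchange_boundary[OF A0, of B0] A0' B0 by metis
  have \<D>': "C \<subseteq> ?S" "card C = k" "finite C" if "C \<in> \<D>" for C
    using subsetD[OF \<D>(1) that] finite_subset[of C ?S] by auto
  note A' = \<D>'[OF A(1)]
  have yS: "y \<in> ?S" using A(4) B0(1) by blast
  note AD = A(1)
  \<comment> \<open>Stated for an arbitrary suitable \<open>y\<close>, because it is applied again
    with another point in its place.\<close>
  have star: "B \<in> \<D>" if A: "x \<in> A" "y \<notin> A" "insert y (A - {x}) \<notin> \<D>" and yS: "y \<in> ?S"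
    and B: "B \<subseteq> ?S" "card B = k" "x \<in> B" "y \<notin> B" for B y
  proof -
    have finB: "finite B" by (rule finite_subset[OF B(1)]) simp
    obtain as where as: "set as = A - B" "distinct as" using finite_distinct_list[of "A - B"] A' by auto
    obtain bs where bs: "set bs = A \<inter> B - {x}" "distinct bs" using finite_distinct_list[of "A \<inter> B - {x}"] A' by auto
    obtain cs where cs: "set cs = B - A" "distinct cs" using finite_distinct_list[of "B - A"] finB by auto
    obtain ds where ds: "set ds = ?S - A - B - {y}" "distinct ds" using finite_distinct_list[of "?S - A - B - {y}"] by auto
    define xs where "xs = y # as @ bs @ x # cs @ ds"
    define a where "a = length as"
    have "distinct xs" unfolding xs_def using as bs cs ds A B by auto
    moreover have "set xs = ?S"
    proof -
      have "set xs = insert y ((A - B) \<union> (A \<inter> B - {x}) \<union> insert x ((B - A) \<union> (?S - A - B - {y})))"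
        using as(1) bs(1) cs(1) ds(1) by (simp add: xs_def Un_assoc insert_commute)
      also have "\<dots> = ?S" using A(1) A'(1) B(1,3) yS by blast
      finally show ?thesis .
    qed
    ultimately obtain p where p: "p permutes ?S" "\<And>i l. i + l \<le> n \<Longrightarrow> p ` arc n i l = set (take l (drop i xs))"
      using permutation_of_list by blast
    have la: "length as = card (A - B)" "length bs = card (A \<inter> B - {x})" "length cs = card (B - A)"
      using distinct_card as bs cs by metis+
    have cAB: "card (A \<inter> B - {x}) + 1 = card (A \<inter> B)"
      using A B A' card_Suc_Diff1[of "A \<inter> B" x] by simp
    have "card (A - B) + card (A \<inter> B) = k" "card (B - A) + card (A \<inter> B) = k"
      using card_Diff_subset_Int[of A B] card_Diff_subset_Int[of B A] A' finB B(2)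
        card_mono[of A "A \<inter> B"] card_mono[of B "A \<inter> B"] by (auto simp: Int_commute)
    then have len: "length as + length bs + 1 = k" "length cs = length as" using la cAB by simp_all
    have "p ` arc n 0 k = set (take k xs)" using p(2)[of 0 k] k by simp
    also have "take k xs = y # as @ bs"
    proof -
      have "(y # as @ bs) @ (x # cs @ ds) = xs" "length (y # as @ bs) = k" using len by (simp_all add: xs_def One_nat_def)
      then show ?thesis by (metis append_eq_conv_conj)
    qed
    also have "set (y # as @ bs) = insert y (A - {x})" using as bs A B by auto
    finally have 0: "p ` arc n 0 k = insert y (A - {x})" .
    have "p ` arc n 1 k = set (take k (drop 1 xs))" using p(2)[of 1 k] k by simp
    also have "take k (drop 1 xs) = as @ bs @ [x]"
    proof -
      have "(as @ bs @ [x]) @ (cs @ ds) = drop 1 xs" "length (as @ bs @ [x]) = k" using len by (simp_all add: xs_def One_nat_def)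
      then show ?thesis by (metis append_eq_conv_conj)
    qed
    also have "set (as @ bs @ [x]) = A" using as bs A B by auto
    finally have 1: "p ` arc n 1 k = A" .
    have "p ` arc n (1 + a) k = set (take k (drop (1 + a) xs))"
      using p(2)[of "1 + a" k] k len by (simp add: a_def)
    also have "take k (drop (1 + a) xs) = bs @ x # cs"
    proof -
      have "(bs @ x # cs) @ ds = drop (1 + a) xs" "length (bs @ x # cs) = k"
        using len by (simp_all add: xs_def a_def One_nat_def)
      then show ?thesis by (metis append_eq_conv_conj)
    qed
    also have "set (bs @ x # cs) = B" using bs cs A B by auto
    finally have 2: "p ` arc n (1 + a) k = B" .
    have "arc n (1 + a) k \<in> trace n p \<D>"
    proof (rule consecutive_arcs[OF k _ intersecting_trace[OF p(1) \<D>(2)] tight[OF p(1)]])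
      show "trace n p \<D> \<subseteq> {I \<in> arcs n. card I = k}"
        using \<D>(1) permutes_card_image[OF p(1)] by (auto simp: trace_def)
      show "arc n 0 k \<notin> trace n p \<D>" using A(3) 0 by (simp add: trace_def)
      show "arc n 1 k \<in> trace n p \<D>" using AD 1 k by (simp add: trace_def arc_in_arcs)
      show "a < k" using len by (simp add: a_def)
    qed
    then show ?thesis using 2 by (simp add: trace_def)
  qed
  \<comment> \<open>Otherwise a \<open>k\<close>-set through \<open>x\<close> that avoids
    \<open>y\<close> and misses \<open>C\<close> is a member: outside \<open>C\<close>,
    \<open>x\<close> and \<open>y\<close> there remain at least \<open>n - k - 2\<close>, hence
    \<open>k - 1\<close>, points.\<close>
  have through: "x \<in> C" if C: "C \<in> \<D>" for C
  proof (rule ccontr)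
    assume x: "x \<notin> C"
    note C' = \<D>'[OF C]
    have "card (insert x (insert y C)) \<le> k + 2"
      using C' by (simp add: card_insert_if)
    moreover have "card (?S - insert x (insert y C)) = n - card (insert x (insert y C))"
      using C' A A' yS by (subst card_Diff_subset) auto
    ultimately have "k - 1 \<le> card (?S - insert x (insert y C))" using k by simp
    then obtain R where R: "R \<subseteq> ?S - insert x (insert y C)" "card R = k - 1" "finite R"
      by (rule obtain_subset_with_card_n)
    have "insert x R \<in> \<D>"
    proof (rule star[OF A(2,3,5) yS])
      show "card (insert x R) = k" using R k by (subst card_insert_disjoint) auto
      show "insert x R \<subseteq> ?S" using R A A' by auto
      show "y \<notin> insert x R" using R A by auto
    qed simp
    moreover have "insert x R \<inter> C = {}" using R x by auto
    ultimately show False using \<D>(2) C unfolding intersecting_def by blast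
  qed
  \<comment> \<open>To include sets through \<open>y\<close>, a point \<open>z\<close> outside
    \<open>A\<close> and \<open>B\<close> takes over: exchanging \<open>x\<close> for
    \<open>z\<close> yields a set without \<open>x\<close>, which is therefore not in
    \<open>\<D>\<close>.\<close>
  have "B \<in> \<D>" if B: "B \<subseteq> ?S" "card B = k" "x \<in> B" for B
  proof -
    have "card (A \<union> B) < card ?S" using card_Un_le[of A B] A' B(2) k(2) by simp
    then obtain z where z: "z \<in> ?S" "z \<notin> A \<union> B"
      using card_mono[of "A \<union> B" ?S] A' finite_subset[OF B(1)] by (metis finite_UnI finite_atLeastAtMost linorder_not_le subsetI)
    have "insert z (A - {x}) \<notin> \<D>" using through z A(2) by auto
    then show ?thesis using z B A(2) by (intro star[of z]) auto
  qed
  then show ?thesis using that[of x] through \<D>(1) A A' by blast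
qed

section \<open>Families without very small or very large sets\<close>

lemma middle_trace_empty:
  assumes p: "p permutes {1..n}" and mid: "middle \<F> = {}"
  shows "middle (trace n p \<F>) = {}"
proof -
  have "p ` M \<in> middle \<F>" if M: "M \<in> middle (trace n p \<F>)" for M
  proof -
    obtain L U where LU: "L \<in> trace n p \<F>" "U \<in> trace n p \<F>" "L \<subset> M" "M \<subset> U" "M \<in> trace n p \<F>"
      using M unfolding middle_def by blast
    have "p ` L \<in> \<F>" "p ` U \<in> \<F>" "p ` M \<in> \<F>" "p ` L \<subset> p ` M" "p ` M \<subset> p ` U"
      using LU permutes_image_psubset[OF p] by (auto simp: trace_def)
    then show ?thesis
      unfolding middle_def by (intro CollectI conjI bexI[of _ "p ` L"] bexI[of _ "p ` U"])
  qed
  then show ?thesis using mid by blast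
qed

text \<open>Some permutation sends a given arc of length \<open>l\<close> to \<open>A\<close>, and
  on that cycle the two complementary levels leave no pair unoccupied.\<close>

lemma pair_complete:
  assumes "intersecting \<F>" "1 \<le> l" "l < n" "A \<subseteq> {1..n}" "card A = l"
    and tight: "\<And>p. p permutes {1..n} \<Longrightarrow>
      card (level (trace n p \<F>) l) + card (level (trace n p \<F>) (n - l)) = n"
  shows "A \<in> \<F> \<or> {1..n} - A \<in> \<F>"
proof -
  have I: "arc n 0 l \<in> arcs n" "card (arc n 0 l) = l" using assms by (simp_all add: arc_in_arcs card_arc)
  obtain p where p: "p permutes {1..n}" "p ` arc n 0 l = A"
    by (rule ex_permutes_image[of "{1..n}" "arc n 0 l" A]) (use assms I arcs_subset[OF I(1)] in auto)
  have "arc n 0 l \<in> trace n p \<F> \<or> {1..n} - arc n 0 l \<in> trace n p \<F>"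
    by (rule level_pair(2)[OF trace_subset intersecting_trace[OF p(1) assms(1)] assms(2,3) tight[OF p(1)] I])
  then show ?thesis using p by (auto simp: trace_def permutes_compl_image)
qed

lemma complete_superset:
  assumes "intersecting \<F>" "B \<in> \<F>" "B \<subseteq> A" "A \<in> \<F> \<or> S - A \<in> \<F>"
  shows "A \<in> \<F>"
proof (rule ccontr)
  assume "A \<notin> \<F>"
  then have "B \<inter> (S - A) \<noteq> {}" using assms unfolding intersecting_def by blast
  then show False using assms(3) by blast
qed

lemma obtain_between:
  assumes "finite S" "A \<subseteq> S" "card A \<le> k" "k \<le> card S"
  obtains X where "A \<subseteq> X" "X \<subseteq> S" "card X = k"
proof -
  have "finite A" using assms finite_subset by blast
  then have "k - card A \<le> card (S - A)" using assms by (simp add: card_Diff_subset)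
  then obtain R where R: "R \<subseteq> S - A" "card R = k - card A" "finite R" by (rule obtain_subset_with_card_n)
  have "card (A \<union> R) = k" using R \<open>finite A\<close> assms by (subst card_Un_disjoint) auto
  then show ?thesis using R assms by (intro that[of "A \<union> R"]) auto
qed

text \<open>Supersets of \<open>A\<close> in the two complete levels are members, because their
  complements miss \<open>A\<close>. A chain from \<open>A\<close> through both levels would make
  the smaller superset a middle set.\<close>

lemma no_member_below_complete_levels:
  assumes \<F>: "intersecting \<F>" "middle \<F> = {}" and S: "finite S" and A: "A \<in> \<F>" "A \<subseteq> S"
    and kl: "card A < k" "k < l" "l \<le> card S"
    and complete: "\<And>X. X \<subseteq> S \<Longrightarrow> card X = k \<or> card X = l \<Longrightarrow> X \<in> \<F> \<or> S - X \<in> \<F>"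
  shows False
proof -
  obtain X where X: "A \<subseteq> X" "X \<subseteq> S" "card X = k" by (rule obtain_between[OF S A(2), of k]) (use kl in auto)
  obtain Y where Y: "X \<subseteq> Y" "Y \<subseteq> S" "card Y = l" by (rule obtain_between[OF S X(2), of l]) (use kl X in auto)
  have "X \<in> \<F>" using complete_superset[OF \<F>(1) A(1) X(1)] complete[OF X(2)] X(3) by blast
  moreover have "Y \<in> \<F>" using complete_superset[OF \<F>(1) A(1), of Y] X(1) Y complete[OF Y(2)] by blast
  moreover have "A \<subset> X" "X \<subset> Y" using X Y kl by auto
  ultimately have "X \<in> middle \<F>" using A(1) unfolding middle_def by blast
  then show False using \<F>(2) by simp
qed

text \<open>The bracket is smallest at \<open>j = 3\<close>, where it is \<open>n - 9\<close>, at
  least 9, and \<open>27 > 16\<close>. Near the middle the binomial coefficient may reach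
  \<open>2 * \<delta>\<close>; there a bracket of 11 suffices, as \<open>33 > 32\<close>.\<close>

lemma weight_bound:
  fixes j n :: nat and \<delta> w :: real
  assumes "18 \<le> n" "3 \<le> j" "j + 3 \<le> n" "0 < \<delta>"
    and "w \<le> \<delta> \<or> (w \<le> 2 * \<delta> \<and> 2 * n + 11 \<le> j * (n - j))"
  shows "16 * w < 3 * \<delta> * (real j * real (n - j) - 2 * real n)"
proof -
  define g where "g = real j * real (n - j) - 2 * real n"
  have k: "real (n - j) = real n - real j" using assms by simp
  have "0 \<le> (real j - 3) * (real n - real j - 3)" using assms by (intro mult_nonneg_nonneg) auto
  also have "\<dots> = g - (real n - 9)" unfolding g_def k by (simp add: algebra_simps)
  finally have 9: "9 \<le> g" using assms(1) by simp
  consider "w \<le> \<delta>" | "w \<le> 2 * \<delta>" "11 \<le> g"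
  proof (cases "w \<le> \<delta>")
    case False
    then have w: "w \<le> 2 * \<delta>" and "real (2 * n + 11) \<le> real (j * (n - j))"
      using assms(5) by (simp_all del: of_nat_add of_nat_mult)
    then have "2 * real n + 11 \<le> real j * real (n - j)"
      by (simp only: of_nat_add of_nat_mult of_nat_numeral)
    then have "11 \<le> g" unfolding g_def by linarith
    then show ?thesis by (rule that(2)[OF w])
  qed (rule that)
  then have "16 * w < 3 * \<delta> * g"
  proof cases
    case 1
    have "\<delta> * 9 \<le> \<delta> * g" using 9 assms(4) by (intro mult_left_mono) auto
    then have "16 * w < 3 * (\<delta> * g)" using 1 assms(4) by linarith
    then show ?thesis by simp
  next
    case 2
    have "\<delta> * 11 \<le> \<delta> * g" using 2 assms(4) by (intro mult_left_mono) auto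
    then have "16 * w < 3 * (\<delta> * g)" using 2 assms(4) by linarith
    then show ?thesis by simp
  qed
  then show ?thesis by (simp add: g_def)
qed

section \<open>Sizes of the extremal families\<close>

lemma Sigma_I_odd: "Sigma_I (2 * m + 1) 2 = ((2 * m + 1) choose (m + 1)) + ((2 * m + 1) choose (m + 2))"
proof -
  have "(2 * m + 1 + 1) div 2 = m + 1" by simp
  moreover have "{m + 1..m + 1 + 2 - 1} = {m + 1, m + 2}" by auto
  ultimately show ?thesis by (simp add: Sigma_I_def One_nat_def)
qed

lemma Sigma_I_even: "Sigma_I (2 * m) 2 =
    ((2 * m - 1) choose (m - 1)) + ((2 * m) choose (m + 1)) + ((2 * m - 1) choose (m + 2))"
  by (simp add: Sigma_I_def One_nat_def)

text \<open>Absorption turns the two coefficients of \<open>2 * m - 1\<close> into multiples of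
  coefficients of \<open>2 * m\<close>. The right side is the bound for a single even cycle.\<close>

lemma Sigma_I_even_cyclic:
  assumes "3 \<le> m"
  shows "real (2 * m) * real (Sigma_I (2 * m) 2) =
    real m * real ((2 * m) choose m) + real (2 * m) * real ((2 * m) choose (m + 1))
    + (real m - 2) * real ((2 * m) choose (m + 2))"
proof -
  have "m * ((2 * m) choose m) = 2 * m * ((2 * m - 1) choose (m - 1))"
    using binomial_absorption[of "m - 1" "2 * m"] assms by simp
  moreover have "(m - 2) * ((2 * m) choose (m + 2)) = 2 * m * ((2 * m - 1) choose (m + 2))"
    using binomial_absorb_comp[of "2 * m" "m + 2"] assms by simp
  moreover have m2: "real (m - 2) = real m - 2" using assms by simp
  ultimately have "real (2 * m) * real ((2 * m - 1) choose (m - 1)) = real m * real ((2 * m) choose m)"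
    "real (2 * m) * real ((2 * m - 1) choose (m + 2)) = (real m - 2) * real ((2 * m) choose (m + 2))"
    by (metis of_nat_mult)+
  then show ?thesis unfolding Sigma_I_even of_nat_add distrib_left by linarith
qed

lemma card_nsets: "finite A \<Longrightarrow> card (nsets A k) = card A choose k"
  unfolding nsets_def using n_subsets[of A k] by (metis (no_types, lifting) Collect_cong finite_subset)

lemma card_nsets_avoiding:
  assumes "finite S" "x \<in> S"
  shows "card {F \<in> nsets S k. x \<notin> F} = (card S - 1) choose k"
proof -
  have "{F \<in> nsets S k. x \<notin> F} = nsets (S - {x}) k" by (auto simp: nsets_def)
  then show ?thesis using assms by (simp add: card_nsets)
qed

lemma card_nsets_through:
  assumes "finite S" "x \<in> S"
  shows "card {F \<in> nsets S (Suc k). x \<in> F} = (card S - 1) choose k"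
proof -
  have fin: "finite (nsets S (Suc k))"
    by (rule finite_subset[of _ "Pow S"]) (use assms in \<open>auto simp: nsets_def\<close>)
  have "nsets S (Suc k) = {F \<in> nsets S (Suc k). x \<in> F} \<union> {F \<in> nsets S (Suc k). x \<notin> F}" by auto
  then have "card (nsets S (Suc k)) = card {F \<in> nsets S (Suc k). x \<in> F} + card {F \<in> nsets S (Suc k). x \<notin> F}"
    using fin by (subst card_Un_disjoint[symmetric]) auto
  moreover have "0 < card S" using assms by (auto simp: card_gt_0_iff)
  then have "card S choose Suc k = ((card S - 1) choose k) + ((card S - 1) choose Suc k)"
    by (cases "card S") auto
  ultimately show ?thesis using assms by (simp add: card_nsets card_nsets_avoiding)
qed

lemma card_H_odd: "card (H_odd (2 * m + 1)) = Sigma_I (2 * m + 1) 2"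
proof -
  let ?S = "{1..2 * m + 1}"
  have fin: "finite (nsets ?S k)" for k
    by (rule finite_subset[of _ "Pow ?S"]) (auto simp: nsets_def)
  have "card (nsets ?S (m + 1) \<union> nsets ?S (m + 2)) = card (nsets ?S (m + 1)) + card (nsets ?S (m + 2))"
    by (rule card_Un_disjoint[OF fin fin]) (auto simp: nsets_def)
  moreover have "card (nsets ?S k) = (2 * m + 1) choose k" for k
    using card_nsets[of ?S k] by (simp only: finite_atLeastAtMost card_atLeastAtMost add_diff_cancel_right' diff_Suc_1 Suc_eq_plus1 simp_thms)
  moreover have "(2 * m + 1) div 2 = m" by simp
  ultimately show ?thesis unfolding H_odd_def Sigma_I_odd by (simp only:)
qed

lemma card_H_even:
  assumes "x \<in> {1..2 * m}"
  shows "card (H_even x (2 * m)) = Sigma_I (2 * m) 2"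
proof -
  let ?S = "{1..2 * m}"
  have m: "m = Suc (m - 1)" using assms by auto
  have fin: "finite (nsets ?S k)" for k
    by (rule finite_subset[of _ "Pow ?S"]) (auto simp: nsets_def)
  have "card (({F \<in> nsets ?S m. x \<in> F} \<union> nsets ?S (m + 1)) \<union> {F \<in> nsets ?S (m + 2). x \<notin> F}) =
      card ({F \<in> nsets ?S m. x \<in> F} \<union> nsets ?S (m + 1)) + card {F \<in> nsets ?S (m + 2). x \<notin> F}"
    by (rule card_Un_disjoint) (use fin in \<open>auto simp: nsets_def\<close>)
  also have "card ({F \<in> nsets ?S m. x \<in> F} \<union> nsets ?S (m + 1)) =
      card {F \<in> nsets ?S m. x \<in> F} + card (nsets ?S (m + 1))"
    by (rule card_Un_disjoint) (use fin in \<open>auto simp: nsets_def\<close>)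
  also have "card {F \<in> nsets ?S m. x \<in> F} = (2 * m - 1) choose (m - 1)"
    using card_nsets_through[of ?S x "m - 1"] assms m by simp
  also have "card (nsets ?S (m + 1)) = (2 * m) choose (m + 1)" by (simp add: card_nsets)
  also have "card {F \<in> nsets ?S (m + 2). x \<notin> F} = (2 * m - 1) choose (m + 2)"
    using card_nsets_avoiding[of ?S x "m + 2"] assms by simp
  finally show ?thesis by (simp add: H_even_def Sigma_I_even)
qed

section \<open>Bound and equality when all sizes lie between 2 and n - 2\<close>

lemma bound_without_extreme_sizes_odd:
  fixes m :: nat
  defines "n \<equiv> 2 * m + 1"
  assumes m: "9 \<le> m" and \<F>: "\<F> \<subseteq> Pow {1..n}" "intersecting \<F>" "butterfly_free \<F>"
    and sizes: "\<And>A. A \<in> \<F> \<Longrightarrow> 2 \<le> card A \<and> card A + 2 \<le> n"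
  shows "card \<F> \<le> Sigma_I n 2" and "card \<F> = Sigma_I n 2 \<Longrightarrow> \<F> = H_odd n"
proof -
  let ?S = "{1..n}"
  define \<delta> where "\<delta> = real (n choose (m + 2))"
  define \<beta> where "\<beta> = real n * real (n choose (m + 1)) + real n * \<delta>"
  have \<beta>: "\<beta> = real n * real (Sigma_I n 2)"
    unfolding \<beta>_def \<delta>_def n_def Sigma_I_odd by (simp add: algebra_simps)
  have "0 < n choose (m + 2)" using m by (simp add: n_def)
  then have \<delta>0: "0 < \<delta>" by (simp add: \<delta>_def)
  \<comment> \<open>An isolated arc gains a full \<open>\<delta>\<close> here; three quarters are
    kept, to match the form shared with the even case.\<close>
  have cyc: "4 * binomial_weight n \<G> + 3 * \<delta> * card (isolated \<G>) \<le> 4 * \<beta>"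
    if "\<G> \<subseteq> arcs n" "intersecting \<G>" "middle \<G> = {}" for \<G>
  proof -
    have "binomial_weight n \<G> + \<delta> * card (isolated \<G>) \<le> \<beta>"
      using cycle_bound_odd(1)[of m \<G>] m that by (simp add: n_def \<delta>_def \<beta>_def)
    moreover have "0 \<le> \<delta> * card (isolated \<G>)" using \<delta>0 by simp
    ultimately show ?thesis by simp
  qed
  \<comment> \<open>The largest coefficient is \<open>(m + 2) / m\<close> times
    \<open>\<delta>\<close>.\<close>
  have mid_le: "real (n choose j) \<le> 2 * \<delta>" for j
  proof -
    have "(m + 2) * (n choose (m + 2)) = m * (n choose (m + 1))"
    proof -
      have "Suc (m + 1) = m + 2" "n - (m + 1) = m" by (simp_all add: n_def)
      then show ?thesis using choose_mult_succ[of "m + 1" n] by metis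
    qed
    moreover have "(m + 2) * (n choose (m + 2)) \<le> (2 * m) * (n choose (m + 2))"
      using m by (intro mult_right_mono) auto
    ultimately have "m * (n choose (m + 1)) \<le> m * (2 * (n choose (m + 2)))" by simp
    then have "n choose (m + 1) \<le> 2 * (n choose (m + 2))" using m by simp
    moreover have "n choose j \<le> n choose (m + 1)"
      using binomial_maximum[of n j] binomial_symmetric[of m n] by (simp add: n_def)
    ultimately have "n choose j \<le> 2 * (n choose (m + 2))" by linarith
    then show ?thesis unfolding \<delta>_def by (metis of_nat_le_iff of_nat_mult of_nat_numeral)
  qed
  have weight: "16 * real (n choose j) < 3 * \<delta> * (real j * real (n - j) - 2 * real n)" if "3 \<le> j" "j + 3 \<le> n" for j
  proof (rule weight_bound[OF _ that \<delta>0])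
    show "real (n choose j) \<le> \<delta> \<or> (real (n choose j) \<le> 2 * \<delta> \<and> 2 * n + 11 \<le> j * (n - j))"
    proof (cases "j = m \<or> j = m + 1")
      case True
      then have "j * (n - j) = m * m + m" by (auto simp: n_def algebra_simps)
      moreover have "9 * m \<le> m * m" using m by (rule mult_right_mono) simp
      moreover have "n = 2 * m + 1" by (simp add: n_def)
      ultimately have "2 * n + 11 \<le> j * (n - j)" using m by linarith
      then show ?thesis using mid_le[of j] by blast
    next
      case False
      have "n choose j \<le> n choose (m + 2)"
      proof (cases "j < m")
        case True
        then have "n choose j \<le> n choose (m - 1)" by (intro binomial_mono) (auto simp: n_def)
        then show ?thesis using binomial_symmetric[of "m - 1" n] m by (simp add: n_def)
      next
        case False
        then show ?thesis using \<open>\<not> (j = m \<or> j = m + 1)\<close> that by (intro binomial_antimono) (auto simp: n_def)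
      qed
      then show ?thesis by (simp add: \<delta>_def)
    qed
  qed (use m in \<open>simp add: n_def\<close>)
  have avg: "real n * card \<F> \<le> \<beta>"
    by (rule cycle_averaging(1)[where \<delta> = \<delta>]) (fact \<F> sizes less_imp_le[OF \<delta>0] cyc weight)+
  have avg_mid: "middle \<F> = {}" if "real n * card \<F> = \<beta>"
    by (rule cycle_averaging(2)[where \<delta> = \<delta>, OF _ _ _ _ _ _ _ that]) (fact \<F> sizes less_imp_le[OF \<delta>0] cyc weight)+
  have avg_tight: "binomial_weight n (trace n p \<F>) = \<beta>" if "real n * card \<F> = \<beta>" "p permutes ?S" for p
    by (rule cycle_averaging(3)[where \<delta> = \<delta>, OF _ _ _ _ _ _ _ that]) (fact \<F> sizes less_imp_le[OF \<delta>0] cyc weight)+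
  have "real (card \<F>) \<le> real (Sigma_I n 2)"
    by (rule mult_left_le_imp_le[of "real n"]) (use avg \<beta> m in \<open>simp_all add: n_def\<close>)
  then show "card \<F> \<le> Sigma_I n 2" by simp
  assume eq: "card \<F> = Sigma_I n 2"
  then have mid: "middle \<F> = {}" and tight: "\<And>p. p permutes ?S \<Longrightarrow> binomial_weight n (trace n p \<F>) = \<beta>"
    using avg_mid avg_tight \<beta> by simp_all
  have counts: "card (level (trace n p \<F>) (m + 1)) + card (level (trace n p \<F>) m) = n"
      "card (level (trace n p \<F>) (m + 2)) + card (level (trace n p \<F>) (m - 1)) = n"
    if p: "p permutes ?S" for p
  proof -
    from cycle_bound_odd(2)[of m "trace n p \<F>"] middle_trace_empty[OF p mid]
    show "card (level (trace n p \<F>) (m + 1)) + card (level (trace n p \<F>) m) = n"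
      "card (level (trace n p \<F>) (m + 2)) + card (level (trace n p \<F>) (m - 1)) = n"
      using m trace_subset intersecting_trace[OF p \<F>(2)] tight[OF p] by (simp_all add: n_def \<delta>_def \<beta>_def)
  qed
  have complete: "A \<in> \<F> \<or> ?S - A \<in> \<F>" if "A \<subseteq> ?S" "card A \<in> {m - 1, m, m + 1, m + 2}" for A
  proof (rule pair_complete[OF \<F>(2) _ _ that(1) refl])
    have n: "n - m = m + 1" "n - (m + 1) = m" "n - (m + 2) = m - 1" "n - (m - 1) = m + 2"
      using m by (auto simp: n_def)
    show "card (level (trace n p \<F>) (card A)) + card (level (trace n p \<F>) (n - card A)) = n" if "p permutes ?S" for p
      using counts[OF that] \<open>card A \<in> _\<close> n by auto
  qed (use that(2) m in \<open>auto simp: n_def\<close>)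
  \<comment> \<open>A member of size \<open>m - 1\<close> would lie below the complete levels
    \<open>m\<close> and \<open>m + 1\<close>, one of size \<open>m\<close> below
    \<open>m + 1\<close> and \<open>m + 2\<close>. Hence every complementary pair is represented by
    its larger set.\<close>
  have none: "card A \<noteq> m - 1 \<and> card A \<noteq> m" if A: "A \<in> \<F>" for A
  proof -
    have AS: "A \<subseteq> ?S" using A \<F>(1) by blast
    have "card A \<noteq> m - 1"
    proof
      assume c: "card A = m - 1"
      show False
        by (rule no_member_below_complete_levels[OF \<F>(2) mid _ A AS, of m "m + 1"])
          (use c m complete in \<open>auto simp: n_def\<close>)
    qed
    moreover have "card A \<noteq> m"
    proof
      assume c: "card A = m"
      show False
        by (rule no_member_below_complete_levels[OF \<F>(2) mid _ A AS, of "m + 1" "m + 2"])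
          (use c m complete in \<open>auto simp: n_def\<close>)
    qed
    ultimately show ?thesis ..
  qed
  have "A \<in> \<F>" if A: "A \<subseteq> ?S" "card A = m + 1 \<or> card A = m + 2" for A
  proof -
    have "finite A" by (rule finite_subset[OF A(1)]) simp
    then have "card (?S - A) = n - card A" using A by (simp add: card_Diff_subset)
    then have "card (?S - A) = m \<or> card (?S - A) = m - 1" using A(2) m by (auto simp: n_def)
    then show ?thesis using complete[OF A(1)] A(2) none[of "?S - A"] by auto
  qed
  then have "H_odd n \<subseteq> \<F>" by (auto simp: H_odd_def nsets_def n_def)
  moreover have "card (H_odd n) = card \<F>" using eq card_H_odd by (simp add: n_def)
  moreover have "finite \<F>" by (rule finite_subset[OF \<F>(1)]) simp
  ultimately show "\<F> = H_odd n" using card_subset_eq by metis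
qed

lemma bound_without_extreme_sizes_even:
  fixes m :: nat
  defines "n \<equiv> 2 * m"
  assumes m: "9 \<le> m" and \<F>: "\<F> \<subseteq> Pow {1..n}" "intersecting \<F>" "butterfly_free \<F>"
    and sizes: "\<And>A. A \<in> \<F> \<Longrightarrow> 2 \<le> card A \<and> card A + 2 \<le> n"
  shows "card \<F> \<le> Sigma_I n 2" and "card \<F> = Sigma_I n 2 \<Longrightarrow> \<exists>x\<in>{1..n}. \<F> = H_even x n"
proof -
  let ?S = "{1..n}"
  define \<delta> where "\<delta> = real (n choose (m + 2))"
  define \<beta> where "\<beta> = real m * real (n choose m) + real n * real (n choose (m + 1)) + (real m - 2) * \<delta>"
  have \<beta>: "\<beta> = real n * real (Sigma_I n 2)"
    unfolding \<beta>_def \<delta>_def n_def using Sigma_I_even_cyclic[of m] m by simp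
  have "0 < n choose (m + 2)" using m by (simp add: n_def)
  then have \<delta>0: "0 < \<delta>" by (simp add: \<delta>_def)
  have cyc: "4 * binomial_weight n \<G> + 3 * \<delta> * card (isolated \<G>) \<le> 4 * \<beta>"
    if "\<G> \<subseteq> arcs n" "intersecting \<G>" "middle \<G> = {}" for \<G>
    using cycle_bound_even(1)[of m \<G>] m that by (simp add: n_def \<delta>_def \<beta>_def)
  have mm: "9 * m \<le> m * m" using m by (rule mult_right_mono) simp
  have mid_le: "real (n choose j) \<le> 2 * \<delta>" for j
  proof -
    have b: "(m + 2) * (n choose (m + 2)) = (m - 1) * (n choose (m + 1))"
    proof -
      have "Suc (m + 1) = m + 2" "n - (m + 1) = m - 1" by (simp_all add: n_def)
      then show ?thesis using choose_mult_succ[of "m + 1" n] by metis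
    qed
    have a: "(m + 1) * (n choose (m + 1)) = m * (n choose m)"
    proof -
      have "Suc m = m + 1" "n - m = m" by (simp_all add: n_def)
      then show ?thesis using choose_mult_succ[of m n] by metis
    qed
    have "(m + 1) * ((m + 2) * (n choose (m + 2))) = (m - 1) * ((m + 1) * (n choose (m + 1)))"
      unfolding b by simp
    also have "\<dots> = (m - 1) * (m * (n choose m))" unfolding a ..
    finally have ab: "(m + 1) * (m + 2) * (n choose (m + 2)) = (m - 1) * m * (n choose m)"
      by (simp only: mult.assoc)
    obtain k where k: "m = Suc k" using m by (cases m) auto
    \<comment> \<open>Two levels away from the centre the coefficient has shrunk by the factor
      \<open>(m - 1) * m / ((m + 1) * (m + 2))\<close>, which is at least one half.\<close>
    have "(m + 1) * (m + 2) \<le> 2 * ((m - 1) * m)" using mm m unfolding k by (simp add: algebra_simps)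
    then have "(m + 1) * (m + 2) * (n choose m) \<le> 2 * ((m - 1) * m) * (n choose m)"
      by (rule mult_right_mono) simp
    also have "\<dots> = (m + 1) * (m + 2) * (2 * (n choose (m + 2)))" using ab by simp
    finally have "n choose m \<le> 2 * (n choose (m + 2))"
      by (rule mult_left_le_imp_le) simp
    moreover have "n choose j \<le> n choose m" using binomial_maximum[of n j] by (simp add: n_def)
    ultimately have "n choose j \<le> 2 * (n choose (m + 2))" by linarith
    then show ?thesis unfolding \<delta>_def by (metis of_nat_le_iff of_nat_mult of_nat_numeral)
  qed
  have weight: "16 * real (n choose j) < 3 * \<delta> * (real j * real (n - j) - 2 * real n)" if "3 \<le> j" "j + 3 \<le> n" for j
  proof (rule weight_bound[OF _ that \<delta>0])
    show "real (n choose j) \<le> \<delta> \<or> (real (n choose j) \<le> 2 * \<delta> \<and> 2 * n + 11 \<le> j * (n - j))"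
    proof (cases "j = m - 1 \<or> j = m \<or> j = m + 1")
      case True
      obtain k where k: "m = Suc k" using m by (cases m) auto
      have "m * m \<le> j * (n - j) + 1" using True unfolding n_def k by (auto simp: algebra_simps)
      moreover have "n = 2 * m" by (simp add: n_def)
      ultimately have "2 * n + 11 \<le> j * (n - j)" using m mm by linarith
      then show ?thesis using mid_le[of j] by blast
    next
      case False
      have "n choose j \<le> n choose (m + 2)"
      proof (cases "j < m")
        case True
        then have "n choose j \<le> n choose (m - 2)" using False by (intro binomial_mono) (auto simp: n_def)
        then show ?thesis using binomial_symmetric[of "m - 2" n] m by (simp add: n_def)
      next
        case False
        then show ?thesis using \<open>\<not> (j = m - 1 \<or> j = m \<or> j = m + 1)\<close> that by (intro binomial_antimono) (auto simp: n_def)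
      qed
      then show ?thesis by (simp add: \<delta>_def)
    qed
  qed (use m in \<open>simp add: n_def\<close>)
  have avg: "real n * card \<F> \<le> \<beta>"
    by (rule cycle_averaging(1)[where \<delta> = \<delta>]) (fact \<F> sizes less_imp_le[OF \<delta>0] cyc weight)+
  have avg_mid: "middle \<F> = {}" if "real n * card \<F> = \<beta>"
    by (rule cycle_averaging(2)[where \<delta> = \<delta>, OF _ _ _ _ _ _ _ that]) (fact \<F> sizes less_imp_le[OF \<delta>0] cyc weight)+
  have avg_tight: "binomial_weight n (trace n p \<F>) = \<beta>" if "real n * card \<F> = \<beta>" "p permutes ?S" for p
    by (rule cycle_averaging(3)[where \<delta> = \<delta>, OF _ _ _ _ _ _ _ that]) (fact \<F> sizes less_imp_le[OF \<delta>0] cyc weight)+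
  have "real (card \<F>) \<le> real (Sigma_I n 2)"
    by (rule mult_left_le_imp_le[of "real n"]) (use avg \<beta> m in \<open>simp_all add: n_def\<close>)
  then show "card \<F> \<le> Sigma_I n 2" by simp
  assume eq: "card \<F> = Sigma_I n 2"
  then have mid: "middle \<F> = {}" and tight: "\<And>p. p permutes ?S \<Longrightarrow> binomial_weight n (trace n p \<F>) = \<beta>"
    using avg_mid avg_tight \<beta> by simp_all
  have counts: "card (level (trace n p \<F>) m) + card (level (trace n p \<F>) m) = n"
      "card (level (trace n p \<F>) (m + 1)) + card (level (trace n p \<F>) (m - 1)) = n"
      "card (level (trace n p \<F>) (m + 2)) + card (level (trace n p \<F>) (m - 2)) = m - 2"
    if p: "p permutes ?S" for p
    using cycle_bound_even(2)[of m "trace n p \<F>"] middle_trace_empty[OF p mid]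
      m trace_subset intersecting_trace[OF p \<F>(2)] tight[OF p] by (simp_all add: n_def \<delta>_def \<beta>_def)
  have complete: "A \<in> \<F> \<or> ?S - A \<in> \<F>" if "A \<subseteq> ?S" "card A \<in> {m - 1, m, m + 1}" for A
  proof (rule pair_complete[OF \<F>(2) _ _ that(1) refl])
    have n: "n - m = m" "n - (m + 1) = m - 1" "n - (m - 1) = m + 1"
      using m by (auto simp: n_def)
    show "card (level (trace n p \<F>) (card A)) + card (level (trace n p \<F>) (n - card A)) = n" if "p permutes ?S" for p
      using counts[OF that] \<open>card A \<in> _\<close> n by auto
  qed (use that(2) m in \<open>auto simp: n_def\<close>)
  have card_compl: "card (?S - A) = n - card A" if "A \<subseteq> ?S" for A
    using that finite_subset[OF that] by (simp add: card_Diff_subset)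
  have none: "card A \<noteq> m - 1" "card A \<noteq> m - 2" if A: "A \<in> \<F>" for A
  proof -
    have AS: "A \<subseteq> ?S" using A \<F>(1) by blast
    have "\<not> card A < m"
    proof
      assume c: "card A < m"
      show False
        by (rule no_member_below_complete_levels[OF \<F>(2) mid _ A AS c, of "m + 1"])
          (use m complete in \<open>auto simp: n_def\<close>)
    qed
    then show "card A \<noteq> m - 1" "card A \<noteq> m - 2" using m by auto
  qed
  have upper: "A \<in> \<F>" if A: "A \<subseteq> ?S" "card A = m + 1" for A
    using complete[OF A(1)] none(1)[of "?S - A"] card_compl[OF A(1)] A(2) by (auto simp: n_def)
  \<comment> \<open>Level \<open>m + 1\<close> is already known to be full, so a set between
    \<open>A\<close> and \<open>C\<close> would be a middle set.\<close>
  have nochain: "A \<notin> \<F>" if C: "C \<in> \<F>" "card C = m + 2" and A: "A \<subseteq> C" "card A = m" for A C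
  proof
    assume AF: "A \<in> \<F>"
    have CS: "C \<subseteq> ?S" using C(1) \<F>(1) by blast
    obtain B where B: "A \<subseteq> B" "B \<subseteq> C" "card B = m + 1"
      by (rule obtain_between[OF finite_subset[OF CS] A(1), of "m + 1"]) (use A C in auto)
    then have "B \<in> \<F>" using upper CS by blast
    moreover have "A \<subset> B" "B \<subset> C" using A B C by auto
    ultimately have "B \<in> middle \<F>" using AF C(1) unfolding middle_def by blast
    then show False using mid by simp
  qed
  \<comment> \<open>Complements have size \<open>m - 2\<close>, less than \<open>n / 2\<close>, as
    \<open>katona_tight_star\<close> requires.\<close>
  define \<D> where "\<D> = (\<lambda>C. ?S - C) ` {C \<in> \<F>. card C = m + 2}"
  have tight\<D>: "card (trace n p \<D>) = m - 2" if p: "p permutes ?S" for p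
  proof -
    have "card I \<noteq> m - 2" if "I \<in> trace n p \<F>" for I
      using none(2)[of "p ` I"] permutes_card_image[OF p, of I] that by (simp add: trace_def)
    then have "level (trace n p \<F>) (m - 2) = {}" by (auto simp: level_def)
    then have c: "card (level (trace n p \<F>) (m + 2)) = m - 2" using counts(3)[OF p] by simp
    have "trace n p \<D> = (\<lambda>I. ?S - I) ` level (trace n p \<F>) (m + 2)"
    proof (intro equalityI subsetI)
      fix I assume "I \<in> trace n p \<D>"
      then obtain C where C: "I \<in> arcs n" "p ` I = ?S - C" "C \<in> \<F>" "card C = m + 2"
        by (auto simp: trace_def \<D>_def)
      have IS: "I \<subseteq> ?S" using C(1) by (rule arcs_subset)
      have "p ` (?S - I) = C"
        using C \<F>(1) permutes_compl_image[OF p, of I] by (auto simp: double_diff)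
      then have "?S - I \<in> level (trace n p \<F>) (m + 2)"
        using C arcs_compl permutes_card_image[OF p, of "?S - I"] by (simp add: level_def trace_def)
      moreover have "I = ?S - (?S - I)" using IS by (simp add: double_diff)
      ultimately show "I \<in> (\<lambda>I. ?S - I) ` level (trace n p \<F>) (m + 2)" by (rule rev_image_eqI)
    next
      fix I assume "I \<in> (\<lambda>I. ?S - I) ` level (trace n p \<F>) (m + 2)"
      then obtain J where J: "I = ?S - J" "J \<in> arcs n" "p ` J \<in> \<F>" "card J = m + 2"
        by (auto simp: level_def trace_def)
      then have "p ` I = ?S - p ` J" using permutes_compl_image[OF p] by simp
      moreover have "card (p ` J) = m + 2" using J(4) permutes_card_image[OF p] by simp
      ultimately have "p ` I \<in> \<D>" using J(3) by (auto simp: \<D>_def)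
      then show "I \<in> trace n p \<D>" using J(1,2) arcs_compl by (simp add: trace_def)
    qed
    moreover have "level (trace n p \<F>) (m + 2) \<subseteq> Pow ?S"
      using trace_subset arcs_subset unfolding level_def by blast
    ultimately show ?thesis using card_image[OF inj_on_compl] c by metis
  qed
  have \<D>sub: "\<D> \<subseteq> {B. B \<subseteq> ?S \<and> card B = m - 2}"
  proof
    fix D assume "D \<in> \<D>"
    then obtain C where "C \<in> \<F>" "card C = m + 2" "D = ?S - C" by (auto simp: \<D>_def)
    then show "D \<in> {B. B \<subseteq> ?S \<and> card B = m - 2}"
      using card_compl[of C] \<F>(1) by (auto simp: n_def)
  qed
  have "intersecting \<D>"
    unfolding intersecting_def
  proof (intro ballI notI)
    fix D D' assume DD: "D \<in> \<D>" "D' \<in> \<D>" "D \<inter> D' = {}"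
    obtain C where C: "C \<in> \<F>" "card C = m + 2" "D = ?S - C" using DD(1) by (auto simp: \<D>_def)
    obtain C' where C': "C' \<in> \<F>" "card C' = m + 2" "D' = ?S - C'" using DD(2) by (auto simp: \<D>_def)
    have CS: "C \<subseteq> ?S" "C' \<subseteq> ?S" using C(1) C'(1) \<F>(1) by blast+
    \<comment> \<open>Any \<open>m\<close>-set \<open>X\<close> between \<open>D\<close> and
      \<open>C'\<close> contradicts the completeness of level \<open>m\<close>: \<open>X\<close>
      lies in \<open>C'\<close> and its complement in \<open>C\<close>, so \<open>nochain\<close>
      excludes both.\<close>
    have sub: "D \<subseteq> C'" using DD(3) C(3) C'(3) by blast
    have "card D = m - 2" using DD(1) \<D>sub by blast
    then obtain X where X: "D \<subseteq> X" "X \<subseteq> C'" "card X = m"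
      using obtain_between[OF finite_subset[OF CS(2)] sub, of m] C'(2) by auto
    have XS: "X \<subseteq> ?S" using X CS by blast
    have "X \<notin> \<F>" by (rule nochain[OF C'(1,2) X(2,3)])
    moreover have "?S - X \<notin> \<F>"
    proof (rule nochain[OF C(1,2)])
      show "?S - X \<subseteq> C" using X(1) C(3) by blast
      show "card (?S - X) = m" using card_compl[OF XS] X(3) by (simp add: n_def)
    qed
    ultimately show False using complete[OF XS] X(3) by simp
  qed
  moreover have "1 \<le> m - 2" "2 * (m - 2) < n" using m by (auto simp: n_def)
  ultimately obtain x where x: "x \<in> ?S" "\<D> = {B. B \<subseteq> ?S \<and> card B = m - 2 \<and> x \<in> B}"
    using katona_tight_star[OF _ _ \<D>sub _ tight\<D>] by metis
  have top: "A \<in> \<F>" if A: "A \<subseteq> ?S" "card A = m + 2" "x \<notin> A" for A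
  proof -
    have "?S - A \<in> \<D>" using A x card_compl[OF A(1)] by (simp add: n_def)
    then obtain C where C: "C \<in> \<F>" "?S - A = ?S - C" by (auto simp: \<D>_def)
    then have "C \<subseteq> ?S" using \<F>(1) by blast
    then have "A = C" using A(1) C(2) by (metis double_diff order_refl)
    then show ?thesis using C(1) by simp
  qed
  \<comment> \<open>The complement of \<open>A\<close> avoids \<open>x\<close> and extends to a
    member of size \<open>m + 2\<close> that still avoids \<open>x\<close>, so it is not a member
    itself.\<close>
  have low: "A \<in> \<F>" if A: "A \<subseteq> ?S" "card A = m" "x \<in> A" for A
  proof -
    obtain D where D: "{x} \<subseteq> D" "D \<subseteq> A" "card D = m - 2"
      by (rule obtain_between[of A "{x}" "m - 2"]) (use A m finite_subset[OF A(1)] in auto)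
    have DS: "D \<subseteq> ?S" using D A by blast
    have "?S - A \<notin> \<F>"
    proof (rule nochain)
      show "card (?S - D) = m + 2" using card_compl[OF DS] D(3) m by (simp add: n_def)
      then show "?S - D \<in> \<F>" using D(1) by (intro top) auto
      show "card (?S - A) = m" using card_compl[OF A(1)] A(2) by (simp add: n_def)
    qed (use D in auto)
    then show ?thesis using complete[OF A(1)] A(2) by simp
  qed
  have "H_even x n \<subseteq> \<F>"
    using top low upper by (auto simp: H_even_def nsets_def n_def)
  moreover have "card (H_even x n) = card \<F>" using eq card_H_even x(1) by (simp add: n_def)
  moreover have "finite \<F>" by (rule finite_subset[OF \<F>(1)]) simp
  ultimately have "\<F> = H_even x n" using card_subset_eq by metis
  then show "\<exists>x\<in>?S. \<F> = H_even x n" using x(1) by blast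
qed

section \<open>Very small and very large sets\<close>

lemma butterfly_freeD:
  assumes "butterfly_free \<F>" "A \<in> \<F>" "B \<in> \<F>" "C \<in> \<F>" "D \<in> \<F>"
    "A \<subseteq> C" "A \<subseteq> D" "B \<subseteq> C" "B \<subseteq> D" "C \<noteq> D" "A \<noteq> C" "A \<noteq> D" "B \<noteq> C" "B \<noteq> D"
  shows "A = B"
proof (rule ccontr)
  assume "A \<noteq> B"
  then have "distinct [A, B, C, D]" using assms by auto
  then show False using assms unfolding butterfly_free_def by blast
qed

text \<open>The subposet need not be induced, so an injection that preserves inclusion carries
  butterflies to butterflies.\<close>

lemma butterfly_free_inj:
  assumes "butterfly_free \<F>" "inj_on \<phi> \<G>" "\<phi> ` \<G> \<subseteq> \<F>"
    and mono: "\<And>A B. A \<in> \<G> \<Longrightarrow> B \<in> \<G> \<Longrightarrow> A \<subseteq> B \<Longrightarrow> \<phi> A \<subseteq> \<phi> B"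
  shows "butterfly_free \<G>"
proof (rule ccontr)
  assume "\<not> butterfly_free \<G>"
  then obtain W X Y Z where b: "W \<in> \<G>" "X \<in> \<G>" "Y \<in> \<G>" "Z \<in> \<G>" "distinct [W, X, Y, Z]"
    "W \<subseteq> Y" "W \<subseteq> Z" "X \<subseteq> Y" "X \<subseteq> Z"
    unfolding butterfly_free_def by blast
  have ne: "\<phi> A \<noteq> \<phi> B" if "A \<in> \<G>" "B \<in> \<G>" "A \<noteq> B" for A B
    using assms(2) that by (auto dest: inj_onD)
  have in\<F>: "\<phi> A \<in> \<F>" if "A \<in> \<G>" for A using assms(3) that by blast
  have "\<phi> W = \<phi> X"
    by (rule butterfly_freeD[OF assms(1) in\<F> in\<F> in\<F> in\<F> mono mono mono mono ne ne ne ne ne,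
          OF b(1,2,3,4,1,3,6) b(1,4,7) b(2,3,8) b(2,4,9) b(3,4) _ b(1,3) _ b(1,4) _ b(2,3) _ b(2,4)])
      (use b(5) in auto)
  then show False using b(5) ne[OF b(1,2)] by simp
qed

text \<open>Sending \<open>X\<close> to \<open>U\<close> and fixing all other members preserves
  inclusion, since whatever lies below or above \<open>X\<close> lies on the same side of
  \<open>U\<close>.\<close>

lemma butterfly_free_swap:
  assumes "butterfly_free \<F>" "U \<in> \<F>" "X \<notin> \<F>"
    and "\<And>A. A \<in> \<F> \<Longrightarrow> A \<noteq> U \<Longrightarrow> A \<subseteq> X \<Longrightarrow> A \<subseteq> U"
    and "\<And>A. A \<in> \<F> \<Longrightarrow> A \<noteq> U \<Longrightarrow> X \<subseteq> A \<Longrightarrow> U \<subseteq> A"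
  shows "butterfly_free (insert X (\<F> - {U}))"
proof (rule butterfly_free_inj[OF assms(1), of "\<lambda>A. if A = X then U else A"])
  show "inj_on (\<lambda>A. if A = X then U else A) (insert X (\<F> - {U}))"
    by (auto simp: inj_on_def)
  show "(\<lambda>A. if A = X then U else A) ` insert X (\<F> - {U}) \<subseteq> \<F>" using assms(2) by auto
  show "(if A = X then U else A) \<subseteq> (if B = X then U else B)"
    if "A \<in> insert X (\<F> - {U})" "B \<in> insert X (\<F> - {U})" "A \<subseteq> B" for A B
    using that assms(4)[of A] assms(5)[of B] by (cases "A = X"; cases "B = X") auto
qed

lemma intersecting_swap:
  assumes "intersecting \<F>" "A0 \<in> \<F>" "A0 \<subseteq> X"
  shows "intersecting (insert X (\<F> - {U}))"
proof -
  have "X \<inter> A \<noteq> {}" "A \<inter> X \<noteq> {}" if "A \<in> \<F>" for A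
  proof -
    have "A0 \<inter> A \<noteq> {}" using assms(1,2) that by (auto simp: intersecting_def)
    then show "X \<inter> A \<noteq> {}" "A \<inter> X \<noteq> {}" using assms(3) by auto
  qed
  moreover have "X \<inter> X \<noteq> {}" using calculation[OF assms(2)] by auto
  ultimately show ?thesis using assms(1) by (auto simp: intersecting_def)
qed

lemma card_swap:
  assumes "finite \<F>" "U \<in> \<F>" "X \<notin> \<F>"
  shows "card (insert X (\<F> - {U})) = card \<F>"
  using assms card.remove[OF assms(1,2)] by simp

lemma card_le_2I:
  assumes "finite X" "\<And>A B. A \<in> X \<Longrightarrow> B \<in> X \<Longrightarrow> A \<noteq> T \<Longrightarrow> B \<noteq> T \<Longrightarrow> A = B"
  shows "card X \<le> 2"
proof -
  have "card (X - {T}) \<le> Suc 0" using assms by (subst card_le_Suc0_iff_eq) auto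
  moreover have "card X \<le> card (X - {T}) + 1"
    using assms(1) by (cases "T \<in> X") (simp_all add: card_Diff_singleton)
  ultimately show ?thesis by simp
qed

section \<open>Families with a common point\<close>

lemma card_star_antichain:
  assumes "finite S" "x \<in> S" "\<A> \<subseteq> Pow S" "antichain \<A>" "\<And>A. A \<in> \<A> \<Longrightarrow> x \<in> A"
  shows "card \<A> \<le> (card S - 1) choose ((card S - 1) div 2)"
proof -
  \<comment> \<open>Removing the common point keeps the antichain property and leaves
    \<open>card S - 1\<close> points for Sperner's theorem.\<close>
  have inj: "inj_on (\<lambda>A. A - {x}) \<A>"
    by (rule inj_on_inverseI[of _ "insert x"]) (use assms(5) in \<open>simp add: insert_absorb\<close>)
  have "antichain ((\<lambda>A. A - {x}) ` \<A>)"
  proof -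
    have "\<not> A - {x} \<subset> B - {x}" if AB: "A \<in> \<A>" "B \<in> \<A>" for A B
    proof
      assume "A - {x} \<subset> B - {x}"
      then have "A \<subset> B" using assms(5)[OF AB(1)] assms(5)[OF AB(2)] by auto
      then show False using assms(4) AB by (auto simp: antichain_def)
    qed
    then show ?thesis by (auto simp: antichain_def)
  qed
  then have "card ((\<lambda>A. A - {x}) ` \<A>) \<le> card (S - {x}) choose (card (S - {x}) div 2)"
    by (rule sperner[rotated 2]) (use assms in auto)
  then show ?thesis using assms(1,2) by (simp add: card_image[OF inj])
qed

text \<open>A chain of four is a butterfly, so the family is exhausted by peeling off the minimal
  members three times, and each layer is an antichain of sets through \<open>x\<close>.\<close>

lemma card_star_butterfly_free:
  assumes "finite S" "x \<in> S" "\<F> \<subseteq> Pow S" "butterfly_free \<F>" "\<And>A. A \<in> \<F> \<Longrightarrow> x \<in> A"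
  shows "card \<F> \<le> 3 * ((card S - 1) choose ((card S - 1) div 2))"
proof -
  define F1 where "F1 = \<F> - minimals \<F>"
  define F2 where "F2 = F1 - minimals F1"
  have fin: "finite \<F>" by (rule finite_subset[OF assms(3)]) (use assms(1) in simp)
  have sub: "minimals \<F> \<subseteq> \<F>" "minimals F1 \<subseteq> \<F>" "minimals F2 \<subseteq> \<F>" by (auto simp: minimals_def F1_def F2_def)
  have "F2 - minimals F2 = {}"
  proof (rule ccontr)
    assume "F2 - minimals F2 \<noteq> {}"
    then obtain Z where "Z \<in> F2" "Z \<notin> minimals F2" by auto
    then obtain Y where Y: "Y \<in> F2" "Y \<subset> Z" by (auto simp: minimals_def)
    then obtain X where X: "X \<in> F1" "X \<subset> Y" by (auto simp: F2_def minimals_def)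
    then obtain W where W: "W \<in> \<F>" "W \<subset> X" by (auto simp: F1_def minimals_def)
    have "W = X"
      by (rule butterfly_freeD[OF assms(4), of W X Y Z])
        (use W X Y \<open>Z \<in> F2\<close> in \<open>auto simp: F1_def F2_def\<close>)
    then show False using W by simp
  qed
  then have "\<F> = minimals \<F> \<union> minimals F1 \<union> minimals F2" using sub by (auto simp: F1_def F2_def)
  then have "card \<F> \<le> card (minimals \<F>) + card (minimals F1) + card (minimals F2)"
    using card_Un_le[of "minimals \<F> \<union> minimals F1" "minimals F2"] card_Un_le[of "minimals \<F>" "minimals F1"] by simp
  moreover have "card L \<le> (card S - 1) choose ((card S - 1) div 2)" if "L \<subseteq> \<F>" "antichain L" for L
    by (rule card_star_antichain[OF assms(1,2)]) (use that assms(3,5) in auto)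
  from this[OF sub(1) antichain_minimals] this[OF sub(2) antichain_minimals] this[OF sub(3) antichain_minimals]
  have "card (minimals \<F>) + card (minimals F1) + card (minimals F2) \<le> 3 * ((card S - 1) choose ((card S - 1) div 2))"
    by linarith
  ultimately show ?thesis by linarith
qed

lemma ratio_le:
  fixes p q u v X Y :: nat
  assumes "p * X = q * Y" "u * p \<le> v * q" "0 < p"
  shows "u * Y \<le> v * X"
proof -
  have "p * (u * Y) = u * p * Y" by simp
  also have "\<dots> \<le> v * q * Y" using assms(2) by (rule mult_right_mono) simp
  also have "\<dots> = v * (p * X)" using assms(1) by simp
  also have "\<dots> = p * (v * X)" by simp
  finally show ?thesis using assms(3) by simp
qed

text \<open>The left side dominates families without an admissible exchange: three antichains in a
  star and two members per point. By Pascal's rule \<open>Sigma_I n 2\<close> is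
  \<open>a + 2 * b + c\<close> or \<open>2 * a + b + c\<close> with consecutive coefficients of
  \<open>n - 1\<close>, the central one being \<open>a\<close>. This exceeds \<open>3 * a\<close> by
  a fixed share of \<open>a\<close>, which outweighs \<open>2 * n\<close>.\<close>

lemma Sigma_I_gt:
  assumes "18 \<le> n"
  shows "3 * ((n - 1) choose ((n - 1) div 2)) + 2 * n < Sigma_I n 2"
proof (cases "odd n")
  case True
  then obtain m where n: "n = 2 * m + 1" by (rule oddE)
  have m: "9 \<le> m" using assms n by simp
  define a b c where "a = (2 * m) choose m" and "b = (2 * m) choose (m + 1)" and "c = (2 * m) choose (m + 2)"
  have "(2 * m + 1) choose (m + 1) = a + b" "(2 * m + 1) choose (m + 2) = b + c"
    by (simp_all add: a_def b_def c_def One_nat_def)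
  then have S: "Sigma_I n 2 = a + 2 * b + c" using Sigma_I_odd[of m] by (simp only: n)
  have "(m + 1) * b = m * a"
  proof -
    have "Suc m = m + 1" "2 * m - m = m" by simp_all
    then show ?thesis using choose_mult_succ[of m "2 * m"] by (simp only: a_def b_def)
  qed
  then have ab: "9 * a \<le> 10 * b" by (rule ratio_le) (use m in auto)
  have "(m + 2) * c = (m - 1) * b"
  proof -
    have "Suc (m + 1) = m + 2" "2 * m - (m + 1) = m - 1" by simp_all
    then show ?thesis using choose_mult_succ[of "m + 1" "2 * m"] by (simp only: b_def c_def)
  qed
  then have bc: "8 * b \<le> 11 * c" by (rule ratio_le) (use m in auto)
  have "(2 * m) choose 2 \<le> a" unfolding a_def by (rule binomial_mono) (use m in auto)
  moreover have "2 * m * 17 \<le> 2 * m * (2 * m - 1)" using m by (intro mult_left_mono) auto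
  ultimately have a: "17 * m \<le> a" using double_choose_2[of "2 * m"] by linarith
  have "(n - 1) choose ((n - 1) div 2) = a" by (simp add: n a_def)
  then show ?thesis unfolding S using ab bc a n m by linarith
next
  case False
  then obtain m where n: "n = 2 * m" by (auto elim: evenE)
  have m: "9 \<le> m" using assms n by simp
  define N where "N = 2 * m - 1"
  have N: "2 * m = Suc N" using m by (simp add: N_def)
  define a b c where "a = N choose m" and "b = N choose (m + 1)" and "c = N choose (m + 2)"
  have a': "N choose (m - 1) = a"
  proof -
    have "N - m = m - 1" "m \<le> N" using m by (simp_all add: N_def)
    then show ?thesis using binomial_symmetric[of m N] by (simp add: a_def)
  qed
  have "(2 * m) choose (m + 1) = a + b" unfolding N by (simp add: a_def b_def One_nat_def)
  then have S: "Sigma_I n 2 = 2 * a + b + c"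
    using Sigma_I_even[of m] a' by (simp add: n N_def[symmetric] c_def)
  have "(m + 1) * b = (m - 1) * a"
  proof -
    have "Suc m = m + 1" "N - m = m - 1" using m by (simp_all add: N_def)
    then show ?thesis using choose_mult_succ[of m N] by (simp only: a_def b_def)
  qed
  then have ab: "4 * a \<le> 5 * b" by (rule ratio_le) (use m in auto)
  have "(m + 2) * c = (m - 2) * b"
  proof -
    have "Suc (m + 1) = m + 2" "N - (m + 1) = m - 2" using m by (simp_all add: N_def)
    then show ?thesis using choose_mult_succ[of "m + 1" N] by (simp only: b_def c_def)
  qed
  then have bc: "7 * b \<le> 11 * c" by (rule ratio_le) (use m in auto)
  have "N choose 2 \<le> N choose (m - 1)" by (rule binomial_mono) (use m in \<open>auto simp: N_def\<close>)
  moreover have "17 * (N - 1) \<le> N * (N - 1)" using m by (intro mult_right_mono) (auto simp: N_def)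
  ultimately have a: "17 * (N - 1) \<le> 2 * a" using double_choose_2[of N] a' by linarith
  have "(n - 1) div 2 = m - 1" using m by (simp add: n)
  then have "(n - 1) choose ((n - 1) div 2) = a" using a' by (simp add: n N_def)
  then show ?thesis unfolding S using ab bc a n m N by linarith
qed

abbreviation (input) extremal :: "nat \<Rightarrow> nat set set \<Rightarrow> bool" where
  "extremal n \<F> \<equiv> (if odd n then \<F> = H_odd n else (\<exists>x\<in>{1..n}. \<F> = H_even x n))"

text \<open>Serves to rule out extremality for a family with a member of size at least
  \<open>n - 2\<close>, which makes its bound strict.\<close>

lemma extremal_small:
  assumes "18 \<le> n" "extremal n \<F>" "A \<in> \<F>"
  shows "card A + 2 < n"
proof -
  have "card A \<le> n div 2 + 2"
    using assms(2,3) by (auto simp: H_odd_def H_even_def nsets_def split: if_splits)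
  then show ?thesis using assms(1) by linarith
qed

lemma card_extremal:
  assumes "extremal n \<F>"
  shows "card \<F> = Sigma_I n 2"
proof (cases "odd n")
  case True
  then obtain m where "n = 2 * m + 1" by (rule oddE)
  then show ?thesis using assms True card_H_odd by simp
next
  case False
  then obtain m where "n = 2 * m" by (auto elim: evenE)
  then show ?thesis using assms False card_H_even by auto
qed

lemma bound_without_extreme_sizes:
  assumes "18 \<le> n" "\<F> \<subseteq> Pow {1..n}" "intersecting \<F>" "butterfly_free \<F>"
    and "\<And>A. A \<in> \<F> \<Longrightarrow> 2 \<le> card A \<and> card A + 2 \<le> n"
  shows "card \<F> \<le> Sigma_I n 2" "card \<F> = Sigma_I n 2 \<Longrightarrow> extremal n \<F>"
proof -
  have "card \<F> \<le> Sigma_I n 2 \<and> (card \<F> = Sigma_I n 2 \<longrightarrow> extremal n \<F>)"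
  proof (cases "odd n")
    case True
    then obtain m where "n = 2 * m + 1" by (rule oddE)
    then show ?thesis using bound_without_extreme_sizes_odd[of m \<F>] assms True by simp
  next
    case False
    then obtain m where "n = 2 * m" by (auto elim: evenE)
    then show ?thesis using bound_without_extreme_sizes_even[of m \<F>] assms False by simp
  qed
  then show "card \<F> \<le> Sigma_I n 2" "card \<F> = Sigma_I n 2 \<Longrightarrow> extremal n \<F>" by auto
qed

lemma singleton_bound:
  assumes "18 \<le> n" "\<F> \<subseteq> Pow {1..n}" "intersecting \<F>" "butterfly_free \<F>" "A \<in> \<F>" "card A = 1"
  shows "card \<F> < Sigma_I n 2"
proof -
  obtain x where x: "A = {x}" using assms(6) by (rule card_1_singletonE)
  then have "x \<in> {1..n}" using assms by auto
  moreover have "x \<in> B" if "B \<in> \<F>" for B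
  proof -
    have "A \<inter> B \<noteq> {}" using assms(3,5) that by (auto simp: intersecting_def)
    then show ?thesis using x by auto
  qed
  ultimately have "card \<F> \<le> 3 * ((n - 1) choose ((n - 1) div 2))"
    using card_star_butterfly_free[of "{1..n}" x \<F>] assms by simp
  then show ?thesis using Sigma_I_gt[OF assms(1)] by linarith
qed

lemma card_UN_le_2:
  assumes "finite Y" "\<And>y. y \<in> Y \<Longrightarrow> card (K y) \<le> 2"
  shows "card (\<Union>y\<in>Y. K y) \<le> 2 * card Y"
proof -
  have "card (\<Union>y\<in>Y. K y) \<le> (\<Sum>y\<in>Y. card (K y))" by (rule card_UN_le[OF assms(1)])
  also have "\<dots> \<le> (\<Sum>y\<in>Y. 2)" by (rule sum_mono) (rule assms(2))
  finally show ?thesis by simp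
qed

text \<open>Each exchange removes a member of size \<open>n - 1\<close> and inserts one of size
  \<open>n - 2\<close>. A member of size at least \<open>n - 2\<close> thus persists until level
  \<open>n - 1\<close> is empty, and there it excludes the extremal families.\<close>

lemma large_member_bound:
  assumes n: "18 \<le> n" and \<F>: "\<F> \<subseteq> Pow {1..n}" "intersecting \<F>" "butterfly_free \<F>" "{1..n} \<notin> \<F>"
    and "A \<in> \<F>" "n \<le> card A + 2"
  shows "card \<F> < Sigma_I n 2"
  using \<F> assms(6,7)
proof (induction "card (level \<F> (n - 1))" arbitrary: \<F> A rule: less_induct)
  case less
  let ?S = "{1..n}"
  note \<F> = less.prems(1-4)
  have fin: "finite \<F>" by (rule finite_subset[OF \<F>(1)]) simp
  have card_le: "card B \<le> n - 1" if "B \<in> \<F>" for B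
  proof -
    have "B \<subseteq> ?S" "B \<noteq> ?S" using that \<F>(1,4) by auto
    then have "card B < card ?S" by (intro psubset_card_mono) auto
    then show ?thesis by simp
  qed
  have ne: "B \<noteq> {}" if "B \<in> \<F>" for B using \<F>(2) that by (auto simp: intersecting_def)
  show ?case
  proof (cases "\<exists>B\<in>\<F>. card B = 1")
    case True
    then show ?thesis using singleton_bound[OF n \<F>(1-3)] by blast
  next
    case no1: False
    show ?thesis
    proof (cases "level \<F> (n - 1) = {}")
      case True
      have "2 \<le> card B \<and> card B + 2 \<le> n" if B: "B \<in> \<F>" for B
      proof -
        have "finite B" using B \<F>(1) by (meson PowD finite_atLeastAtMost finite_subset subsetD)
        then have "card B \<noteq> 0" using ne[OF B] by simp
        moreover have "card B \<noteq> 1" "card B \<noteq> n - 1" using no1 True B by (auto simp: level_def)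
        ultimately show ?thesis using card_le[OF B] by linarith
      qed
      note core = bound_without_extreme_sizes[OF n \<F>(1-3) this]
      have "\<not> extremal n \<F>" using extremal_small[OF n _ less.prems(5)] less.prems(6) by fastforce
      then show ?thesis using core by fastforce
    next
      case False
      then obtain U where U: "U \<in> \<F>" "card U = n - 1" by (auto simp: level_def)
      have US: "U \<subseteq> ?S" using U(1) \<F>(1) by blast
      then have "card (?S - U) = 1" using U(2) n finite_subset[OF US] by (simp add: card_Diff_subset)
      then obtain x where "?S - U = {x}" by (rule card_1_singletonE)
      then have x: "x \<in> ?S" "x \<notin> U" "U = ?S - {x}" using US by auto
      have finU: "finite U" by (rule finite_subset[OF US]) simp
      show ?thesis
      \<comment> \<open>Replacing \<open>U\<close> by \<open>U - {y}\<close> stays intersecting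
        because of the member \<open>B\<close> inside it. The set \<open>?S - {y}\<close> must be
        absent, as it would contain the new member but not \<open>U\<close>.\<close>
      proof (cases "\<exists>y\<in>U. \<exists>B\<in>\<F>. B \<subseteq> U - {y} \<and> U - {y} \<notin> \<F> \<and> ?S - {y} \<notin> \<F>")
        case True
        then obtain y B where y: "y \<in> U" "B \<in> \<F>" "B \<subseteq> U - {y}" "U - {y} \<notin> \<F>" "?S - {y} \<notin> \<F>" by blast
        define X where "X = U - {y}"
        define \<F>' where "\<F>' = insert X (\<F> - {U})"
        have cX: "card X = n - 2" using y(1) U(2) finU by (simp add: X_def)
        have "butterfly_free \<F>'"
          unfolding \<F>'_def
        proof (rule butterfly_free_swap[OF \<F>(3) U(1)])
          show "X \<notin> \<F>" using y(4) by (simp add: X_def)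
          show "C \<subseteq> U" if "C \<subseteq> X" for C using that by (auto simp: X_def)
          show "U \<subseteq> C" if C: "C \<in> \<F>" "C \<noteq> U" "X \<subseteq> C" for C
          proof (rule ccontr)
            assume "\<not> U \<subseteq> C"
            then have "y \<notin> C" using C(3) by (auto simp: X_def)
            moreover have "C \<subseteq> ?S" using C(1) \<F>(1) by blast
            ultimately have "C = X \<or> C = ?S - {y}" using C(3) x y(1) unfolding X_def by blast
            then show False using C(1) y(4,5) by (auto simp: X_def)
          qed
        qed
        moreover have "intersecting \<F>'"
          unfolding \<F>'_def by (rule intersecting_swap[OF \<F>(2) y(2)]) (use y(3) in \<open>simp add: X_def\<close>)
        moreover have "\<F>' \<subseteq> Pow ?S" using \<F>(1) US by (auto simp: \<F>'_def X_def)
        moreover have "X \<noteq> ?S" using x(1,2) by (metis DiffD1 X_def)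
        then have "?S \<notin> \<F>'" using \<F>(4) by (simp add: \<F>'_def)
        moreover have "card (level \<F>' (n - 1)) < card (level \<F> (n - 1))"
        proof (rule psubset_card_mono)
          show "finite (level \<F> (n - 1))" using fin by (simp add: level_def)
          have "card X \<noteq> n - 1" using cX n by linarith
          then have "level \<F>' (n - 1) \<subseteq> level \<F> (n - 1) - {U}" by (auto simp: level_def \<F>'_def)
          moreover have "U \<in> level \<F> (n - 1)" using U by (simp add: level_def)
          ultimately show "level \<F>' (n - 1) \<subset> level \<F> (n - 1)" by blast
        qed
        moreover have "X \<in> \<F>'" "n \<le> card X + 2" using cX by (auto simp: \<F>'_def)
        ultimately have "card \<F>' < Sigma_I n 2" by (intro less.hyps)
        moreover have "card \<F>' = card \<F>"
          unfolding \<F>'_def by (rule card_swap[OF fin U(1)]) (use y(4) in \<open>simp add: X_def\<close>)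
        ultimately show ?thesis by simp
      next
        case False
        define K where "K y = {B \<in> \<F>. B \<subset> U \<and> y \<notin> B}" for y
        \<comment> \<open>If \<open>K y\<close> is nonempty and no exchange is possible, a member
          \<open>T\<close> other than \<open>U\<close> contains \<open>U - {y}\<close>; two members
          of \<open>K y\<close> besides \<open>T\<close> would form a butterfly with
          \<open>T\<close> and \<open>U\<close>.\<close>
        have "card (K y) \<le> 2" if y: "y \<in> U" for y
        proof (cases "K y = {}")
          case ne: False
          then obtain B where "B \<in> \<F>" "B \<subseteq> U - {y}" by (auto simp: K_def)
          then have "U - {y} \<in> \<F> \<or> ?S - {y} \<in> \<F>" using False y by blast
          then obtain T where T: "T \<in> \<F>" "T = U - {y} \<or> T = ?S - {y}" by blast
          have T': "U - {y} \<subseteq> T" "T \<noteq> U" using T(2) y US by auto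
          show ?thesis
          proof (rule card_le_2I[of _ T])
            show "finite (K y)" using fin by (simp add: K_def)
            show "B = C" if "B \<in> K y" "C \<in> K y" "B \<noteq> T" "C \<noteq> T" for B C
              by (rule butterfly_freeD[OF \<F>(3), of B C T U]) (use that T(1) T' U(1) in \<open>auto simp: K_def\<close>)
          qed
        qed simp
        then have "card (\<Union>y\<in>U. K y) \<le> 2 * (n - 1)" using card_UN_le_2[OF finU] U(2) by metis
        moreover have "card {B \<in> \<F>. x \<in> B} \<le> 3 * ((n - 1) choose ((n - 1) div 2))"
        proof -
          have "butterfly_free {B \<in> \<F>. x \<in> B}"
            by (rule butterfly_free_inj[OF \<F>(3), of id]) auto
          moreover have "{B \<in> \<F>. x \<in> B} \<subseteq> Pow ?S" using \<F>(1) by blast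
          ultimately have "card {B \<in> \<F>. x \<in> B} \<le> 3 * ((card ?S - 1) choose ((card ?S - 1) div 2))"
            using x(1) by (intro card_star_butterfly_free[of ?S x]) simp_all
          then show ?thesis by simp
        qed
        \<comment> \<open>A member that avoids \<open>x\<close> lies inside \<open>U\<close> and, if
          different from \<open>U\<close>, misses a point of \<open>U\<close>.\<close>
        moreover have "\<F> \<subseteq> insert U ((\<Union>y\<in>U. K y) \<union> {B \<in> \<F>. x \<in> B})"
        proof
          fix B assume B: "B \<in> \<F>"
          show "B \<in> insert U ((\<Union>y\<in>U. K y) \<union> {B \<in> \<F>. x \<in> B})"
          proof (cases "x \<in> B \<or> B = U")
            case False
            then have "B \<subset> U" using B \<F>(1) x(3) by auto
            then show ?thesis using B by (auto simp: K_def)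
          qed (use B in auto)
        qed
        then have "card \<F> \<le> card (insert U ((\<Union>y\<in>U. K y) \<union> {B \<in> \<F>. x \<in> B}))"
          using fin finU by (intro card_mono) (auto simp: K_def)
        moreover have "\<dots> \<le> Suc (card ((\<Union>y\<in>U. K y) \<union> {B \<in> \<F>. x \<in> B}))"
          using fin finU by (simp add: card_insert_if K_def)
        moreover have "card ((\<Union>y\<in>U. K y) \<union> {B \<in> \<F>. x \<in> B}) \<le> card (\<Union>y\<in>U. K y) + card {B \<in> \<F>. x \<in> B}"
          by (rule card_Un_le)
        ultimately show ?thesis using Sigma_I_gt[OF n] n by linarith
      qed
    qed
  qed
qed

text \<open>A single exchange of the full set for \<open>?S - {x}\<close> leads to
  \<open>large_member_bound\<close>. If none is possible, each point is avoided by at most two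
  members, since two further members below \<open>?S - {x}\<close> and the full set would complete a
  butterfly.\<close>

lemma full_set_bound:
  assumes n: "18 \<le> n" and \<F>: "\<F> \<subseteq> Pow {1..n}" "intersecting \<F>" "butterfly_free \<F>" "{1..n} \<in> \<F>"
  shows "card \<F> < Sigma_I n 2"
proof -
  let ?S = "{1..n}"
  have fin: "finite \<F>" by (rule finite_subset[OF \<F>(1)]) simp
  show ?thesis
  proof (cases "\<exists>x\<in>?S. \<exists>B\<in>\<F>. x \<notin> B \<and> ?S - {x} \<notin> \<F>")
    case True
    then obtain x B where x: "x \<in> ?S" "B \<in> \<F>" "x \<notin> B" "?S - {x} \<notin> \<F>" by blast
    define X where "X = ?S - {x}"
    define \<F>' where "\<F>' = insert X (\<F> - {?S})"
    have cX: "card X = n - 1" using x(1) by (simp add: X_def)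
    have "card \<F>' < Sigma_I n 2"
    proof (rule large_member_bound[OF n])
      show "butterfly_free \<F>'" unfolding \<F>'_def
      proof (rule butterfly_free_swap[OF \<F>(3,4)])
        show "X \<notin> \<F>" using x by (simp add: X_def)
        show "C \<subseteq> ?S" if "C \<subseteq> X" for C using that by (auto simp: X_def)
        show "?S \<subseteq> C" if C: "C \<in> \<F>" "C \<noteq> ?S" "X \<subseteq> C" for C
        proof (rule ccontr)
          assume "\<not> ?S \<subseteq> C"
          then have "x \<notin> C" using C(3) by (auto simp: X_def)
          moreover have "C \<subseteq> ?S" using C(1) \<F>(1) by blast
          ultimately have "C = X" using C(3) unfolding X_def by blast
          then show False using C(1) x(4) by (simp add: X_def)
        qed
      qed
      have "B \<subseteq> X" using x \<F>(1) by (auto simp: X_def)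
      then show "intersecting \<F>'" unfolding \<F>'_def by (rule intersecting_swap[OF \<F>(2) x(2)])
      show "\<F>' \<subseteq> Pow ?S" using \<F>(1) by (auto simp: \<F>'_def X_def)
      have "x \<notin> X" by (simp add: X_def)
      then have "X \<noteq> ?S" using x(1) by metis
      then show "?S \<notin> \<F>'" by (simp add: \<F>'_def)
      show "X \<in> \<F>'" "n \<le> card X + 2" using cX by (auto simp: \<F>'_def)
    qed
    moreover have "card \<F>' = card \<F>"
      unfolding \<F>'_def by (rule card_swap[OF fin \<F>(4)]) (use x(4) in \<open>simp add: X_def\<close>)
    ultimately show ?thesis by simp
  next
    case False
    define K where "K x = {B \<in> \<F>. B \<noteq> ?S \<and> x \<notin> B}" for x
    have "card (K x) \<le> 2" if x: "x \<in> ?S" for x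
    proof (cases "K x = {}")
      case ne: False
      then obtain B where "B \<in> \<F>" "x \<notin> B" by (auto simp: K_def)
      then have T: "?S - {x} \<in> \<F>" using False x by blast
      show ?thesis
      proof (rule card_le_2I[of _ "?S - {x}"])
        show "finite (K x)" using fin by (simp add: K_def)
        show "B = C" if "B \<in> K x" "C \<in> K x" "B \<noteq> ?S - {x}" "C \<noteq> ?S - {x}" for B C
          by (rule butterfly_freeD[OF \<F>(3), of B C "?S - {x}" ?S])
            (use that T \<F>(1,4) x in \<open>auto simp: K_def\<close>)
      qed
    qed simp
    then have "card (\<Union>x\<in>?S. K x) \<le> 2 * n" using card_UN_le_2[of ?S K] by simp
    moreover have "\<F> \<subseteq> insert ?S (\<Union>x\<in>?S. K x)"
      using \<F>(1) by (auto simp: K_def)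
    then have "card \<F> \<le> card (insert ?S (\<Union>x\<in>?S. K x))"
      using fin by (intro card_mono) (auto simp: K_def)
    moreover have "\<dots> \<le> Suc (card (\<Union>x\<in>?S. K x))"
      using fin by (simp add: card_insert_if K_def)
    moreover have "0 < (n - 1) choose ((n - 1) div 2)" by simp
    ultimately show ?thesis using Sigma_I_gt[OF n] by linarith
  qed
qed

theorem theorem9:
  fixes n :: nat and \<F> :: "nat set set"
  assumes "n \<ge> 18"
    and "\<F> \<subseteq> Pow {1..n}"
    and "intersecting \<F>"
    and "butterfly_free \<F>"
  shows "card \<F> \<le> Sigma_I n 2 \<and>
    (card \<F> = Sigma_I n 2 \<longleftrightarrow>
      (if odd n then \<F> = H_odd n else (\<exists>x\<in>{1..n}. \<F> = H_even x n)))"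
proof -
  have "card \<F> \<le> Sigma_I n 2 \<and> (card \<F> = Sigma_I n 2 \<longrightarrow> extremal n \<F>)"
  proof (cases "\<exists>A\<in>\<F>. A = {1..n} \<or> card A = 1 \<or> n \<le> card A + 1")
    case True
    then have "card \<F> < Sigma_I n 2"
      using full_set_bound[OF assms] singleton_bound[OF assms] large_member_bound[OF assms] by fastforce
    then show ?thesis by simp
  next
    case False
    have "2 \<le> card A \<and> card A + 2 \<le> n" if A: "A \<in> \<F>" for A
    proof -
      have "A \<noteq> {}" "finite A" using A assms(2,3) by (auto simp: intersecting_def intro: finite_subset)
      then have "card A \<noteq> 0" by simp
      moreover have "\<not> (A = {1..n} \<or> card A = 1 \<or> n \<le> card A + 1)" using False A by blast
      ultimately show ?thesis by linarith
    qed
    then show ?thesis using bound_without_extreme_sizes[OF assms] by blast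
  qed
  then show ?thesis using card_extremal by blast
qed

end
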